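(* Let $f(z)$ be a function holomorphic in $\mathbb{C}_+$ and continuous in $\overline{\mathbb{C}_+}$, whose zeros in $\mathbb{C}_+$ have bounded multiplicities (there is $N$ such that every zero of $f$ in $\mathbb{C}_+$ has multiplicity at most $N$), and such that $\log(1/|f(x)|)=\mathcal{O}(|x|)$ as $|x|\to\infty$, $x\in\mathbb{R}$. Assume that for some constants $\alpha\ge 0$, $C>0$, $M\ge 0$ we have $$|f(z)|\le C(1+|z|)^M e^{\alpha\,\mathrm{Im}\, z},\qquad z\in\overline{\mathbb{C}_+}.$$ Moreover, suppose that there exist $k>0$ and $c>0$ such that the set $\Lambda$ of the zeros of $f$ in $\mathbb{C}_+$ satisfies the following conditions: (i) $\mathrm{Im}\,\lambda\ge 1$ for every $\lambda\in\Lambda$; (ii) if $\lambda,\mu\in\Lambda$, $\lambda\neq\mu$, and if $\mathrm{Im}\,\lambda\le k|\mathrm{Re}\,\lambda|$ and $\mathrm{Im}\,\mu\le k|\mathrm{Re}\,\mu|$, then $$|\lambda-\mu|\ge c\,(|\lambda|+|\mu|)^{-1/4}.$$ Then $$-\log|f(x+i/2)|=\mathcal{O}(|x|),\qquad |x|\to\infty,\ x\in\mathbb{R}.$$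
   Context: $\mathbb{C}_+=\{z\in\mathbb{C}:\mathrm{Im}\, z>0\}$ is the open upper half-plane and $\overline{\mathbb{C}_+}=\{z\in\mathbb{C}:\mathrm{Im}\, z\ge 0\}$. *)

theory Defs
  imports "HOL-Complex_Analysis.Complex_Analysis" "HOL-Library.Landau_Symbols"
begin

end

theory Submission
  imports Defs "HOL-Real_Asymp.Real_Asymp"
begin

text \<open>
  Division by \<open>exp (- \<i> \<alpha> z)\<close> and by a constant multiple of \<open>(z + \<i>) powr M\<close> turns \<open>f\<close> into a function
  \<open>F\<close> bounded by 1 in the closed upper half-plane, with the same zeros and multiplicities; on the lines
  \<open>Im z = 0\<close> and \<open>Im z = 1 / 2\<close> it changes \<open>ln |f|\<close> by \<open>O(|x|)\<close> only. Fix a large \<open>|x|\<close> and write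
  \<open>F = G * B\<close>, where \<open>B\<close> is the finite Blaschke product of the zeros of \<open>F\<close> in the upper half of the disc of radius
  \<open>9 |x|\<close> and \<open>|G| \<le> 1\<close> (\<open>finite_blaschke_factorization\<close>). Comparing the two sides at the fixed point
  \<open>\<i> / 2\<close>, which is not a zero, bounds both \<open>- ln |G(\<i> / 2)|\<close> and \<open>- ln |B(\<i> / 2)|\<close> independently of \<open>x\<close>.
  
  \<^bold>\<open>The factor without zeros.\<close> The function \<open>- ln |G|\<close> is harmonic and nonnegative in a half-disc of radius
  proportional to \<open>|x|\<close>. Harnack's inequality, starting at \<open>\<i> / 2\<close>, gives the bound \<open>O(|x|\<^sup>2 / Im z)\<close> at points
  \<open>z\<close> with \<open>|z| = O(|x|)\<close> (\<open>zero_free_lower_bound_interior\<close>). On the real axis \<open>|G| = |F|\<close>, so there the hypothesis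
  bounds it by \<open>O(|x|)\<close>. The maximum principle in a half-disc about \<open>x\<close>, with an explicit comparison function,
  combines the two bounds to \<open>O(|x|)\<close> at \<open>x + \<i> / 2\<close> (\<open>zero_free_lower_bound_near_real_axis\<close>).
  
  \<^bold>\<open>The Blaschke product.\<close> The contribution of a zero \<open>l\<close> to \<open>- ln |B(z)|\<close> at \<open>z = x + \<i> / 2\<close> is at most
  \<open>Im l / |z - l|\<^sup>2\<close> times its multiplicity, and the multiplicities are bounded. The bound on
  \<open>- ln |B(\<i> / 2)|\<close> gives \<open>\<Sum> Im l = O(|x|\<^sup>2)\<close> over the zeros in question, which settles the zeros
  at distance at least \<open>sqrt |x|\<close> from \<open>z\<close>. The nearer ones lie in the sector where the zeros are separated by a
  multiple of \<open>|x| powr (-1/4)\<close>, and satisfy \<open>Im l \<le> 2 |z - l|\<close>; a packing argument bounds the sum of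
  \<open>1 / |z - l|\<close> over them by \<open>O(sqrt |x| * sqrt |x|)\<close> (\<open>separated_zeros_sum_le\<close>).
\<close>

section \<open>Harnack's inequality\<close>

text \<open>
  Harnack's inequality for the nonnegative harmonic function \<open>- ln |g|\<close>, in a form that is symmetric in
  the two values: it bounds the value at \<open>z\<close> by the value at the centre, and conversely. It is the
  Schwarz lemma for a branch \<open>H\<close> of \<open>- log g\<close>, composed with the Cayley-type map
  \<open>(H - H 0) / (H + cnj (H 0))\<close> of the right half-plane onto the disc.
\<close>

lemma harnack_ln_norm:
  fixes g :: "complex \<Rightarrow> complex"
  assumes holg: "g holomorphic_on ball q R" and R: "0 < R"
    and nz: "\<And>z. z \<in> ball q R \<Longrightarrow> g z \<noteq> 0" and le1: "\<And>z. z \<in> ball q R \<Longrightarrow> norm (g z) \<le> 1"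
    and z: "z \<in> ball q R"
  shows "\<bar>ln (norm (g z)) - ln (norm (g q))\<bar>
           \<le> dist q z / R * (- ln (norm (g z)) - ln (norm (g q)))"
proof -
  have "simply_connected (ball q R)"
    by (simp add: convex_imp_simply_connected)
  then obtain h where holh: "h holomorphic_on ball q R" and gh: "\<And>z. z \<in> ball q R \<Longrightarrow> g z = exp (h z)"
    using holg nz by (metis simply_connected_eq_holomorphic_log open_ball)
  have Reh: "ln (norm (g w)) = Re (h w)" if "w \<in> ball q R" for w
    using gh[OF that] by simp
  have Reh0: "Re (h w) \<le> 0" if "w \<in> ball q R" for w
    using Reh[OF that] le1[OF that] nz[OF that] by (metis ln_le_zero_iff zero_less_norm_iff)
  define w where "w = (z - q) / of_real R"
  have w1: "norm w < 1" and nw: "norm w = dist q z / R"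
    using z R by (simp_all add: w_def norm_divide dist_norm norm_minus_commute)
  have in_ball: "q + of_real R * v \<in> ball q R" if "norm v < 1" for v :: complex
    using that R by (simp add: dist_norm norm_mult)
  have qw: "q + of_real R * w = z"
    using R by (simp add: w_def)
  have "\<bar>Re (h z) - Re (h q)\<bar> \<le> norm w * (- Re (h z) - Re (h q)) + \<epsilon>" if "\<epsilon> > 0" for \<epsilon>
  proof -
    \<comment> \<open>The shift by \<open>\<epsilon> / 2\<close> makes the real part strictly positive, so that the quotient below maps into
       the open disc even if \<open>|g|\<close> attains the value 1.\<close>
    define H where "H = (\<lambda>v. of_real (\<epsilon> / 2) - h (q + of_real R * v))"
    define \<phi> where "\<phi> = (\<lambda>v. (H v - H 0) / (H v + cnj (H 0)))"
    have ReH: "Re (H v) > 0" if "norm v < 1" for v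
      using Reh0[OF in_ball[OF that]] \<open>\<epsilon> > 0\<close> by (simp add: H_def)
    have den: "H v + cnj (H 0) \<noteq> 0" if "norm v < 1" for v
    proof
      assume "H v + cnj (H 0) = 0"
      then have "Re (H v + cnj (H 0)) = 0" by simp
      with ReH[OF that] ReH[of 0] show False by simp
    qed
    have holH: "H holomorphic_on ball 0 1"
    proof -
      have "(h \<circ> (\<lambda>v. q + of_real R * v)) holomorphic_on ball 0 1"
        using in_ball by (intro holomorphic_on_compose_gen[OF _ holh] holomorphic_intros) auto
      then show ?thesis
        unfolding H_def o_def by (intro holomorphic_intros)
    qed
    have "\<phi> holomorphic_on ball 0 1"
      unfolding \<phi>_def using den by (intro holomorphic_intros holH) auto
    moreover have "\<phi> 0 = 0" by (simp add: \<phi>_def)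
    moreover have sq: "(norm (H v - H 0))\<^sup>2 = (Re (H v) - Re (H 0))\<^sup>2 + (Im (H v) - Im (H 0))\<^sup>2"
         "(norm (H v + cnj (H 0)))\<^sup>2 = (Re (H v) + Re (H 0))\<^sup>2 + (Im (H v) - Im (H 0))\<^sup>2" for v
      by (simp_all add: cmod_power2)
    moreover have "norm (\<phi> v) < 1" if "norm v < 1" for v
    proof -
      have "0 < Re (H v) * Re (H 0)" using ReH[OF that] ReH[of 0] by simp
      then have "(Re (H v) - Re (H 0))\<^sup>2 < (Re (H v) + Re (H 0))\<^sup>2"
        by (simp add: power2_eq_square algebra_simps)
      then have "(norm (H v - H 0))\<^sup>2 < (norm (H v + cnj (H 0)))\<^sup>2"
        using sq[of v] by simp
      then have "norm (H v - H 0) < norm (H v + cnj (H 0))"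
        by (simp add: power_less_imp_less_base)
      then show ?thesis
        using den[OF that] by (simp add: \<phi>_def norm_divide)
    qed
    ultimately have "norm (\<phi> w) \<le> norm w"
      using Schwarz_Lemma(1) w1 by blast
    then have A: "norm (H w - H 0) \<le> norm w * norm (H w + cnj (H 0))"
      using den[OF w1] by (simp add: \<phi>_def norm_divide divide_le_eq)
    define u where "u = Re (H w)"
    define u0 where "u0 = Re (H 0)"
    define d where "d = Im (H w) - Im (H 0)"
    have pos: "u > 0" "u0 > 0" using ReH[OF w1] ReH[of 0] by (auto simp: u_def u0_def)
    have "(norm (H w - H 0))\<^sup>2 \<le> (norm w)\<^sup>2 * (norm (H w + cnj (H 0)))\<^sup>2"
      using A by (metis norm_ge_zero power_mono power_mult_distrib)
    then have "(u - u0)\<^sup>2 + d\<^sup>2 \<le> (norm w)\<^sup>2 * ((u + u0)\<^sup>2 + d\<^sup>2)"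
      unfolding sq u_def u0_def d_def by simp
    moreover have "(norm w)\<^sup>2 * d\<^sup>2 \<le> d\<^sup>2"
      using w1 by (simp add: mult_left_le_one_le power_le_one)
    \<comment> \<open>Both moduli have the same imaginary contribution \<open>d\<^sup>2\<close>, and dropping it on the two sides is harmless
       because \<open>|w| < 1\<close>.\<close>
    ultimately have "(u - u0)\<^sup>2 \<le> (norm w)\<^sup>2 * (u + u0)\<^sup>2"
      unfolding distrib_left by linarith
    then have "(u - u0)\<^sup>2 \<le> (norm w * (u + u0))\<^sup>2"
      by (simp only: power_mult_distrib)
    then have "\<bar>u - u0\<bar> \<le> \<bar>norm w * (u + u0)\<bar>"
      by (simp only: abs_le_square_iff)
    also have "\<dots> = norm w * (u + u0)"
      using pos by (simp add: abs_mult)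
    finally have "\<bar>u - u0\<bar> \<le> norm w * (u + u0)" .
    then have "\<bar>Re (h z) - Re (h q)\<bar> \<le> norm w * (- Re (h z) - Re (h q)) + norm w * \<epsilon>"
      unfolding u_def u0_def H_def qw by (simp add: algebra_simps abs_minus_commute)
    also have "norm w * \<epsilon> \<le> \<epsilon>"
      using w1 that by (simp add: mult_left_le_one_le)
    finally show ?thesis by simp
  qed
  then have "\<bar>Re (h z) - Re (h q)\<bar> \<le> norm w * (- Re (h z) - Re (h q))"
    by (rule field_le_epsilon)
  then show ?thesis
    using Reh[OF z] Reh[of q] R by (simp add: nw)
qed

section \<open>Lower bounds for functions without zeros\<close>

text \<open>
  If \<open>G\<close> has no zeros in a large half-disc, then \<open>- ln |G|\<close> grows there at most like \<open>R\<^sup>2 / y\<close> with the height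
  \<open>y\<close>, the constant depending on the value at the single point \<open>\<i> / 2\<close> only. Harnack's inequality is applied
  three times, in discs of radius \<open>R\<close> tangent to the real axis: from \<open>\<i> / 2\<close> to \<open>\<i> R\<close>, from there to \<open>t + \<i> R\<close>, and down
  to \<open>t + \<i> y\<close>.
\<close>

lemma zero_free_lower_bound_interior:
  fixes G :: "complex \<Rightarrow> complex" and R t y :: real
  assumes hol: "G holomorphic_on {z. Im z > 0}"
    and le1: "\<And>z. Im z > 0 \<Longrightarrow> norm (G z) \<le> 1"
    and nz: "\<And>z. \<lbrakk>Im z > 0; norm z < 3 * R\<rbrakk> \<Longrightarrow> G z \<noteq> 0"
    and R: "R \<ge> 1" and t: "\<bar>t\<bar> \<le> R / 2" and y: "0 < y" "y \<le> R"
  shows "- ln (norm (G (Complex t y))) \<le> 24 * R\<^sup>2 / y * - ln (norm (G (\<i> / 2)))"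
proof -
  define u where "u = (\<lambda>z. - ln (norm (G z)))"
  have har: "\<bar>u w - u q\<bar> \<le> dist q w / R * (u w + u q)"
    if q: "Im q = R" "\<bar>Re q\<bar> \<le> R / 2" and w: "dist q w < R" for q w
  proof -
    have nq: "norm q \<le> 3 / 2 * R"
      using cmod_le[of q] q R by linarith
    have ball: "Im v > 0" "norm v < 3 * R" if "v \<in> ball q R" for v
    proof -
      have "\<bar>Im (q - v)\<bar> < R" using that abs_Im_le_cmod[of "q - v"] by (auto simp: dist_norm)
      then show "Im v > 0" using q by simp
      have "norm (q - v) < R" using that by (simp add: dist_norm)
      then show "norm v < 3 * R" using nq R norm_triangle_ineq4[of q "q - v"] by simp
    qed
    have "G holomorphic_on ball q R"
      using ball by (intro holomorphic_on_subset[OF hol]) auto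
    from harnack_ln_norm[OF this, of w] ball nz le1 w R
    show ?thesis by (simp add: u_def abs_minus_commute)
  qed
  have u0: "u z \<ge> 0" if "Im z > 0" "norm z < 3 * R" for z
    using le1[OF that(1)] nz[OF that] by (simp add: u_def)
  have ui: "u (\<i> / 2) \<ge> 0" using R by (intro u0) auto
  have "u (Complex 0 R) \<le> 4 * R * u (\<i> / 2)"
  proof -
    have "dist (Complex 0 R) (\<i> / 2) = R - 1 / 2"
    proof -
      have "Complex 0 R - \<i> / 2 = of_real (R - 1 / 2) * \<i>" by (simp add: complex_eq_iff)
      then have "dist (Complex 0 R) (\<i> / 2) = \<bar>R - 1 / 2\<bar>"
        unfolding dist_norm by (simp only: norm_mult norm_of_real norm_ii mult_1_right)
      then show ?thesis using R by simp
    qed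
    with har[of "Complex 0 R" "\<i> / 2"] R
    have "u (Complex 0 R) - u (\<i> / 2) \<le> (R - 1 / 2) / R * (u (\<i> / 2) + u (Complex 0 R))"
      by auto
    then have "R * (u (Complex 0 R) - u (\<i> / 2)) \<le> (R - 1 / 2) * (u (\<i> / 2) + u (Complex 0 R))"
      using R by (simp add: field_simps)
    then have "u (Complex 0 R) \<le> 4 * R * u (\<i> / 2) - u (\<i> / 2)"
      by (simp add: algebra_simps)
    then show ?thesis using ui by simp
  qed
  moreover have "u (Complex t R) \<le> 3 * u (Complex 0 R)"
  proof -
    have d: "dist (Complex 0 R) (Complex t R) = \<bar>t\<bar>"
      by (simp add: dist_norm cmod_def)
    have p: "u (Complex t R) \<ge> 0" "u (Complex 0 R) \<ge> 0"
      using R t cmod_le[of "Complex t R"] by (auto intro!: u0 simp: complex_norm)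
    have "\<bar>t\<bar> / R * (u (Complex t R) + u (Complex 0 R)) \<le> 1 / 2 * (u (Complex t R) + u (Complex 0 R))"
      using t R p by (intro mult_right_mono) (auto simp: field_simps)
    moreover have "\<bar>u (Complex t R) - u (Complex 0 R)\<bar>
        \<le> \<bar>t\<bar> / R * (u (Complex t R) + u (Complex 0 R))"
      using har[of "Complex 0 R" "Complex t R"] R t d by auto
    ultimately have "\<bar>u (Complex t R) - u (Complex 0 R)\<bar> \<le> 1 / 2 * (u (Complex t R) + u (Complex 0 R))"
      by (rule order_trans[rotated])
    then show ?thesis unfolding abs_le_iff by simp
  qed
  moreover have "u (Complex t y) \<le> 2 * R / y * u (Complex t R)"
  proof -
    have "dist (Complex t R) (Complex t y) = R - y"
      using y by (simp add: dist_norm cmod_def)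
    with har[of "Complex t R" "Complex t y"] R t y
    have "u (Complex t y) - u (Complex t R) \<le> (R - y) / R * (u (Complex t y) + u (Complex t R))"
      by auto
    then have "R * (u (Complex t y) - u (Complex t R)) \<le> (R - y) * (u (Complex t y) + u (Complex t R))"
      using R by (simp add: field_simps)
    then have "y * u (Complex t y) \<le> 2 * R * u (Complex t R) - y * u (Complex t R)"
      by (simp add: algebra_simps)
    moreover have "y * u (Complex t R) \<ge> 0"
      using R t y cmod_le[of "Complex t R"] by (intro mult_nonneg_nonneg u0) auto
    ultimately show ?thesis using y by (simp add: field_simps)
  qed
  ultimately have "u (Complex t y) \<le> 2 * R / y * (3 * (4 * R * u (\<i> / 2)))"
    using R y by (smt (verit) mult_left_mono divide_nonneg_pos)
  then show ?thesis by (simp add: u_def power2_eq_square)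
qed

text \<open>
  The interior bound deteriorates like \<open>1 / y\<close> at the real axis. Near \<open>x\<close>, where \<open>G\<close> is also bounded below on the
  real axis, it is improved to a bound without that factor, by the maximum principle in the half-disc of
  radius \<open>\<rho> = |x| / 2\<close> about \<open>x\<close>, whose end points on the axis are \<open>a\<close> and \<open>b\<close>. The comparison function is
  \<open>Re P z = y / |z - a|\<^sup>2 + y / |z - b|\<^sup>2\<close>: it is harmonic and nonnegative, it equals exactly \<open>1 / y\<close> on the
  circular arc, and it is only of size \<open>1 / \<rho>\<^sup>2\<close> at \<open>x + \<i> / 2\<close>, which compensates the factor \<open>R\<^sup>2\<close>.
\<close>

lemma zero_free_lower_bound_near_real_axis:
  fixes G :: "complex \<Rightarrow> complex" and x L :: real
  assumes hol: "G holomorphic_on {z. Im z > 0}" and cont: "continuous_on {z. Im z \<ge> 0} G"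
    and le1: "\<And>z. Im z \<ge> 0 \<Longrightarrow> norm (G z) \<le> 1"
    and nz: "\<And>z. \<lbrakk>Im z > 0; norm z < 9 * \<bar>x\<bar>\<rbrakk> \<Longrightarrow> G z \<noteq> 0"
    and real: "\<And>t. \<bar>t - x\<bar> \<le> \<bar>x\<bar> / 2 \<Longrightarrow> norm (G (of_real t)) \<ge> exp (- L)"
    and x: "\<bar>x\<bar> \<ge> 2"
  shows "- ln (norm (G (of_real x + \<i> / 2))) \<le> L + 864 * - ln (norm (G (\<i> / 2)))"
proof -
  define \<rho> where "\<rho> = \<bar>x\<bar> / 2"
  define a where "a = complex_of_real (x - \<rho>)"
  define b where "b = complex_of_real (x + \<rho>)"
  define v0 where "v0 = - ln (norm (G (\<i> / 2)))"
  define K where "K = 216 * x\<^sup>2 * v0"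
  define P where "P = (\<lambda>z. \<i> / (z - a) + \<i> / (z - b))"
  have \<rho>: "\<rho> \<ge> 1" using x by (simp add: \<rho>_def)
  have "v0 \<ge> 0"
    using le1[of "\<i> / 2"] nz[of "\<i> / 2"] x by (simp add: v0_def)
  then have K: "K \<ge> 0" by (simp add: K_def)
  have ReP: "Re (P z) = Im z / (norm (z - a))\<^sup>2 + Im z / (norm (z - b))\<^sup>2" for z
    by (simp add: P_def Re_divide' a_def b_def cmod_power2)
  have ReP0: "Re (P z) \<ge> 0" if "Im z \<ge> 0" for z
    unfolding ReP using that by simp
  have ReP_arc: "Re (P z) = 1 / Im z" if "cmod (z - of_real x) = \<rho>" "Im z > 0" for z
  proof -
    define s where "s = Re z - x"
    have e: "s\<^sup>2 + (Im z)\<^sup>2 = \<rho>\<^sup>2"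
      using that(1) cmod_power2[of "z - of_real x"] by (simp add: s_def)
    have na: "(norm (z - a))\<^sup>2 = 2 * \<rho> * (\<rho> + s)" and nb: "(norm (z - b))\<^sup>2 = 2 * \<rho> * (\<rho> - s)"
      using e unfolding cmod_power2 a_def b_def s_def by (simp_all add: power2_eq_square algebra_simps)
    have y2: "(\<rho> + s) * (\<rho> - s) = Im z * Im z"
      using e by (simp add: power2_eq_square algebra_simps)
    then have ne: "\<rho> + s \<noteq> 0" "\<rho> - s \<noteq> 0" using that(2) by auto
    have "Re (P z) = Im z * ((\<rho> - s) + (\<rho> + s)) / (2 * \<rho> * ((\<rho> + s) * (\<rho> - s)))"
      unfolding ReP na nb using ne \<rho> by (simp add: divide_simps) (simp add: algebra_simps)
    also have "\<dots> = 1 / Im z"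
      unfolding y2 using \<rho> that(2) by (simp add: field_simps)
    finally show ?thesis .
  qed
  have inside: "norm z < 9 * \<bar>x\<bar>" if "cmod (z - of_real x) \<le> \<rho>" for z
    using that x norm_triangle_ineq2[of z "of_real x"] by (simp add: \<rho>_def)
  have nz': "G z \<noteq> 0" if "cmod (z - of_real x) \<le> \<rho>" "Im z \<ge> 0" for z
  proof (cases "Im z = 0")
    case True
    then have z: "z = of_real (Re z)" by (simp add: complex_eq_iff)
    then have "z - of_real x = of_real (Re z - x)" by simp
    then have "\<bar>Re z - x\<bar> \<le> \<bar>x\<bar> / 2" using that(1) by (simp only: norm_of_real \<rho>_def)
    from real[OF this] z show ?thesis
      by (metis exp_gt_zero norm_zero not_less)
  qed (use that nz inside in auto)
  have arc: "norm (G z) \<ge> exp (- K * Re (P z))" if "cmod (z - of_real x) = \<rho>" "Im z > 0" for z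
  proof -
    have "\<bar>Re z - x\<bar> \<le> \<rho>" using abs_Re_le_cmod[of "z - of_real x"] that(1) by simp
    then have t: "\<bar>Re z\<bar> \<le> 3 * \<bar>x\<bar> / 2" unfolding \<rho>_def by linarith
    have "Im z \<le> \<rho>" using abs_Im_le_cmod[of "z - of_real x"] that(1) by simp
    \<comment> \<open>The interior bound with \<open>R = 3 |x|\<close>, which explains the radius \<open>9 |x|\<close> in the hypothesis.\<close>
    then have "- ln (norm (G (Complex (Re z) (Im z)))) \<le> 24 * (3 * \<bar>x\<bar>)\<^sup>2 / Im z * v0"
      unfolding v0_def using that t x
      by (intro zero_free_lower_bound_interior hol le1 nz) (auto simp: \<rho>_def)
    then have "ln (norm (G z)) \<ge> - K * Re (P z)"
      unfolding ReP_arc[OF that] by (simp add: K_def algebra_simps)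
    then show ?thesis
      using nz'[of z] that by (simp add: ln_ge_iff)
  qed
  define z0 where "z0 = complex_of_real x + \<i> / 2"
  have "- ln (norm (G z0)) \<le> L + 864 * v0 + \<eta>" if "\<eta> > 0" for \<eta>
  proof -
    \<comment> \<open>The comparison function is singular at the corners \<open>a\<close> and \<open>b\<close>. Small discs about them are removed, in
       which the lower bound for \<open>|G|\<close> on the axis persists by continuity up to \<open>\<eta>\<close>.\<close>
    have "\<exists>\<delta>>0. \<forall>z. Im z \<ge> 0 \<and> dist z p \<le> \<delta> \<longrightarrow> norm (G z) \<ge> exp (- L - \<eta>)" if "p = a \<or> p = b" for p
    proof -
      have p: "Im p = 0" using that by (auto simp: a_def b_def)
      have pl: "norm (G p) > exp (- L - \<eta>)"
      proof -
        have "norm (G p) \<ge> exp (- L)" using that real[of "x - \<rho>"] real[of "x + \<rho>"]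
          by (auto simp: a_def b_def \<rho>_def)
        then show ?thesis using \<open>\<eta> > 0\<close> by (smt (verit) exp_less_cancel_iff)
      qed
      have "((\<lambda>z. norm (G z)) \<longlongrightarrow> norm (G p)) (at p within {z. Im z \<ge> 0})"
        using cont p by (intro tendsto_norm) (auto simp: continuous_on_def)
      from order_tendstoD(1)[OF this pl] obtain d where "d > 0"
        and d: "\<And>z. Im z \<ge> 0 \<Longrightarrow> z \<noteq> p \<Longrightarrow> dist z p < d \<Longrightarrow> norm (G z) > exp (- L - \<eta>)"
        unfolding eventually_at by auto
      show ?thesis
      proof (intro exI[of _ "d / 2"] conjI allI impI)
        fix z assume "0 \<le> Im z \<and> dist z p \<le> d / 2"
        then show "exp (- L - \<eta>) \<le> norm (G z)"
          using d[of z] pl \<open>d > 0\<close> by (cases "z = p") auto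
      qed (use \<open>d > 0\<close> in auto)
    qed
    then obtain da db where "da > 0" "db > 0" 
      and da: "\<And>z. Im z \<ge> 0 \<Longrightarrow> dist z a \<le> da \<Longrightarrow> norm (G z) \<ge> exp (- L - \<eta>)"
      and db: "\<And>z. Im z \<ge> 0 \<Longrightarrow> dist z b \<le> db \<Longrightarrow> norm (G z) \<ge> exp (- L - \<eta>)"
      by metis
    define \<delta> where "\<delta> = Min {da, db, 1 / 2}"
    have \<delta>: "\<delta> > 0" "\<delta> \<le> da" "\<delta> \<le> db" "\<delta> \<le> 1 / 2"
      using \<open>da > 0\<close> \<open>db > 0\<close> by (auto simp: \<delta>_def)
    define S where "S = ball (of_real x) \<rho> \<inter> {z. Im z > 0} - cball a \<delta> - cball b \<delta>"
    define H where "H = (\<lambda>z. exp (- of_real K * P z) / G z)"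
    have "open S" unfolding S_def by (intro open_Diff open_Int open_ball open_halfspace_Im_gt closed_cball)
    have clS: "closure S \<subseteq> cball (of_real x) \<rho> \<inter> {z. Im z \<ge> 0} - ball a \<delta> - ball b \<delta>"
      unfolding S_def by (rule closure_minimal) (auto intro!: closed_Diff closed_Int closed_halfspace_Im_ge)
    have ne: "a \<notin> closure S" "b \<notin> closure S"
      using clS \<delta>(1) by auto
    have nzS: "G z \<noteq> 0" if "z \<in> closure S" for z
      using clS that by (intro nz') (auto simp: dist_norm norm_minus_commute)
    have normH: "norm (H z) = exp (- K * Re (P z)) / norm (G z)" for z
      by (simp add: H_def norm_divide)
    have "norm (H z0) \<le> exp (L + \<eta>)"
    proof (rule maximum_modulus_frontier[of H S])
      have SS: "S \<subseteq> closure S" by (rule closure_subset)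
      have "S \<subseteq> {z. Im z > 0}" by (auto simp: S_def)
      then show "H holomorphic_on interior S"
        unfolding H_def P_def interior_open[OF \<open>open S\<close>] using nzS ne SS
        by (intro holomorphic_intros holomorphic_on_subset[OF hol]) auto
      have "closure S \<subseteq> {z. Im z \<ge> 0}" using clS by auto
      then show "continuous_on (closure S) H"
        unfolding H_def P_def using nzS ne
        by (intro continuous_intros continuous_on_subset[OF cont]) auto
      show "bounded S" unfolding S_def by (intro bounded_diff bounded_Int) auto
      have "dist a z0 > \<delta>"  "dist b z0 > \<delta>"
      proof -
        have "\<rho> \<le> norm (a - z0)" "\<rho> \<le> norm (b - z0)"
          using abs_Re_le_cmod[of "a - z0"] abs_Re_le_cmod[of "b - z0"] \<rho>
          by (simp_all add: a_def b_def z0_def)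
        then show "dist a z0 > \<delta>"  "dist b z0 > \<delta>" using \<delta> \<rho> by (auto simp: dist_norm)
      qed
      then show "z0 \<in> S" using \<rho> by (simp add: S_def z0_def dist_norm)
      fix z assume z: "z \<in> frontier S"
      then have zc: "z \<in> closure S" and "z \<notin> S" using \<open>open S\<close> by (auto simp: frontier_def interior_open)
      have z1: "cmod (z - of_real x) \<le> \<rho>" "Im z \<ge> 0" using zc clS by (auto simp: dist_norm norm_minus_commute)
      have Gpos: "norm (G z) > 0" using nzS[OF zc] by simp
      have *: "norm (H z) \<le> exp (L + \<eta>)" if "norm (G z) \<ge> exp (- L - \<eta>)"
      proof -
        have "exp (- K * Re (P z)) / norm (G z) \<le> 1 / norm (G z)"
          using K ReP0[OF z1(2)] by (intro divide_right_mono) auto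
        also have "\<dots> \<le> 1 / exp (- L - \<eta>)"
          using that by (intro divide_left_mono) (auto intro!: mult_pos_pos Gpos)
        also have "\<dots> = exp (L + \<eta>)" by (simp add: exp_minus[symmetric] inverse_eq_divide[symmetric])
        finally show ?thesis by (simp add: normH)
      qed
      consider "Im z = 0" | "cmod (z - of_real x) = \<rho>" "Im z > 0" | "dist z a \<le> \<delta>" | "dist z b \<le> \<delta>"
        using \<open>z \<notin> S\<close> z1 by (force simp: S_def dist_norm norm_minus_commute)
      then show "norm (H z) \<le> exp (L + \<eta>)"
      proof cases
        case 1
        then have zr: "z = of_real (Re z)" by (simp add: complex_eq_iff)
        then have "z - of_real x = of_real (Re z - x)" by simp
        then have "\<bar>Re z - x\<bar> \<le> \<bar>x\<bar> / 2" using z1(1) by (simp only: norm_of_real \<rho>_def)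
        from real[OF this] have "norm (G z) \<ge> exp (- L)" using zr by simp
        moreover have "exp (- L) \<ge> exp (- L - \<eta>)" using \<open>\<eta> > 0\<close> by simp
        ultimately show ?thesis by (intro *) linarith
      next
        case 2
        have "norm (H z) \<le> 1" unfolding normH using arc[OF 2] Gpos by (simp add: divide_le_eq)
        moreover have "0 \<le> L"
        proof -
          have "exp (- L) \<le> norm (G (of_real x))" using real[of x] by simp
          also have "\<dots> \<le> 1" by (intro le1) simp
          finally show ?thesis by simp
        qed
        then have "1 \<le> exp (L + \<eta>)" using \<open>\<eta> > 0\<close> by simp
        ultimately show ?thesis by linarith
      next
        case 3 then show ?thesis using da[of z] z1 \<delta> by (intro *) auto
      next
        case 4 then show ?thesis using db[of z] z1 \<delta> by (intro *) auto
      qed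
    qed
    moreover have z0: "cmod (z0 - of_real x) \<le> \<rho>" "Im z0 > 0"
      using \<rho> by (auto simp: z0_def)
    have Gz0: "norm (G z0) > 0" using nz'[OF z0(1)] z0(2) by simp
    ultimately have "ln (exp (- K * Re (P z0)) / norm (G z0)) \<le> ln (exp (L + \<eta>))"
      unfolding normH by (subst ln_le_cancel_iff) auto
    then have "- ln (norm (G z0)) \<le> L + \<eta> + K * Re (P z0)"
      using Gz0 by (simp add: ln_div)
    also have "K * Re (P z0) \<le> K * (4 / x\<^sup>2)"
    proof (intro mult_left_mono K)
      have n: "(norm (z0 - a))\<^sup>2 = \<rho>\<^sup>2 + 1 / 4" "(norm (z0 - b))\<^sup>2 = \<rho>\<^sup>2 + 1 / 4"
        unfolding cmod_power2 by (simp_all add: z0_def a_def b_def power2_eq_square)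
      have "Re (P z0) = 2 * ((1 / 2) / (\<rho>\<^sup>2 + 1 / 4))"
        unfolding ReP n by (simp add: z0_def)
      also have "\<dots> = 1 / (\<rho>\<^sup>2 + 1 / 4)" by (simp only: times_divide_eq_right)
      also have "\<dots> \<le> 1 / \<rho>\<^sup>2"
        using \<rho> by (intro divide_left_mono mult_pos_pos add_pos_pos) auto
      also have "\<dots> = 4 / x\<^sup>2" by (simp add: \<rho>_def power2_eq_square)
      finally show "Re (P z0) \<le> 4 / x\<^sup>2" .
    qed
    also have "K * (4 / x\<^sup>2) = 864 * v0" using x by (auto simp: K_def)
    finally show ?thesis by simp
  qed
  then show ?thesis unfolding v0_def z0_def by (rule field_le_epsilon)
qed

section \<open>Blaschke factors of the upper half-plane\<close>

text \<open>
  The Blaschke factor with zero \<open>l\<close> in the upper half-plane, normalised to tend to 1 at infinity. It has modulus 1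
  on the real axis and modulus less than 1 in the upper half-plane.
\<close>

definition blaschke :: "complex \<Rightarrow> complex \<Rightarrow> complex" where
  "blaschke l z = (z - l) / (z - cnj l)"

lemma blaschke_den_nonzero: "\<lbrakk>Im l > 0; Im z \<ge> 0\<rbrakk> \<Longrightarrow> z - cnj l \<noteq> 0"
  by (auto simp: complex_eq_iff)

lemma blaschke_nonzero: "\<lbrakk>Im l > 0; Im z \<ge> 0; z \<noteq> l\<rbrakk> \<Longrightarrow> blaschke l z \<noteq> 0"
  using blaschke_den_nonzero[of l z] by (simp add: blaschke_def)

lemma holomorphic_on_blaschke: "Im l > 0 \<Longrightarrow> blaschke l holomorphic_on {z. Im z > 0}"
  unfolding blaschke_def[abs_def] using blaschke_den_nonzero
  by (intro holomorphic_intros) auto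

lemma continuous_on_blaschke: "Im l > 0 \<Longrightarrow> continuous_on {z. Im z \<ge> 0} (blaschke l)"
  unfolding blaschke_def[abs_def] using blaschke_den_nonzero
  by (intro continuous_intros) auto

lemma norm_blaschke_real:
  assumes "Im l > 0" "Im z = 0"
  shows "norm (blaschke l z) = 1"
proof -
  have "cnj (z - l) = z - cnj l" using assms(2) by (simp add: complex_eq_iff)
  then have "norm (z - l) = norm (z - cnj l)" by (metis complex_mod_cnj)
  then show ?thesis using assms blaschke_den_nonzero[of l z] by (simp add: blaschke_def norm_divide)
qed

lemma tendsto_blaschke_at_infinity: "(blaschke l \<longlongrightarrow> 1) at_infinity"
proof -
  have inv: "((\<lambda>z. inverse (z - cnj l)) \<longlongrightarrow> 0) at_infinity"
    using tendsto_add_filterlim_at_infinity'[OF filterlim_ident tendsto_const, of "- cnj l"]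
    by (intro filterlim_compose[OF tendsto_inverse_0]) simp
  have "((\<lambda>z. 1 - (l - cnj l) * inverse (z - cnj l)) \<longlongrightarrow> 1 - (l - cnj l) * 0) at_infinity"
    by (intro tendsto_intros inv)
  moreover have "\<forall>\<^sub>F z in at_infinity. 1 - (l - cnj l) * inverse (z - cnj l) = blaschke l z"
  proof -
    have "\<forall>\<^sub>F z in at_infinity. z \<noteq> cnj l"
      using eventually_not_equal_at_infinity by blast
    then show ?thesis
      by eventually_elim (simp add: blaschke_def field_simps)
  qed
  ultimately show ?thesis by (simp add: tendsto_cong)
qed

lemma one_minus_norm_blaschke_sq:
  assumes "Im l > 0" "Im z \<ge> 0"
  shows "1 - (norm (blaschke l z))\<^sup>2 = 4 * Im z * Im l / (norm (z - cnj l))\<^sup>2"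
proof -
  have "(norm (z - cnj l))\<^sup>2 \<noteq> 0" using blaschke_den_nonzero[OF assms] by simp
  moreover have "(norm (z - cnj l))\<^sup>2 - (norm (z - l))\<^sup>2 = 4 * Im z * Im l"
    unfolding cmod_power2 by (simp add: power2_eq_square algebra_simps)
  ultimately show ?thesis
    by (simp add: blaschke_def norm_divide power_divide diff_divide_eq_iff)
qed

text \<open>
  The lower bound and the upper bound that follows are \<open>ln t \<le> t - 1\<close>, applied to \<open>|b|\<^sup>2\<close> and to \<open>1 / |b|\<^sup>2\<close>, where \<open>b\<close> is the value of the
  Blaschke factor. The lower bound has \<open>z - cnj l\<close> in the denominator and the upper bound \<open>z - l\<close>.
\<close>

lemma neg_ln_norm_blaschke_lower:
  assumes "Im l > 0" "Im z > 0" "z \<noteq> l"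
  shows "2 * Im z * Im l / (norm (z - cnj l))\<^sup>2 \<le> - ln (norm (blaschke l z))"
proof -
  have pos: "norm (blaschke l z) > 0" using blaschke_nonzero[of l z] assms by simp
  have "2 * ln (norm (blaschke l z)) = ln ((norm (blaschke l z))\<^sup>2)"
    using pos by (simp add: ln_realpow)
  also have "\<dots> \<le> (norm (blaschke l z))\<^sup>2 - 1"
    using pos by (intro ln_le_minus_one) auto
  finally show ?thesis
    using one_minus_norm_blaschke_sq[of l z] assms by simp
qed

lemma neg_ln_norm_blaschke_upper:
  assumes "Im l > 0" "Im z > 0" "z \<noteq> l"
  shows "- ln (norm (blaschke l z)) \<le> 2 * Im z * Im l / (norm (z - l))\<^sup>2"
proof -
  have pos: "norm (blaschke l z) > 0" using blaschke_nonzero[of l z] assms by simp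
  have ne: "norm (z - l) > 0" "norm (z - cnj l) > 0"
    using assms blaschke_den_nonzero[of l z] by auto
  have "- 2 * ln (norm (blaschke l z)) = ln (inverse ((norm (blaschke l z))\<^sup>2))"
    using pos by (simp add: ln_realpow ln_inverse)
  also have "\<dots> \<le> inverse ((norm (blaschke l z))\<^sup>2) - 1"
    using pos by (intro ln_le_minus_one) auto
  also have "\<dots> = (1 - (norm (blaschke l z))\<^sup>2) / (norm (blaschke l z))\<^sup>2"
    using pos by (simp add: field_simps)
  also have "\<dots> = 4 * Im z * Im l / (norm (z - cnj l))\<^sup>2 / (norm (blaschke l z))\<^sup>2"
    using one_minus_norm_blaschke_sq[of l z] assms by simp
  also have "\<dots> = 4 * Im z * Im l / (norm (z - l))\<^sup>2"
    using ne by (simp add: blaschke_def norm_divide power_divide)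
  finally show ?thesis by simp
qed

text \<open>
  A Phragmen-Lindeloef principle in the simplest case: the growth at infinity is controlled by a hypothesis, so
  the maximum principle in large half-discs suffices.
\<close>

lemma maximum_modulus_upper_half_plane:
  fixes G :: "complex \<Rightarrow> complex"
  assumes hol: "G holomorphic_on {z. Im z > 0}" and cont: "continuous_on {z. Im z \<ge> 0} G"
    and real: "\<And>z. Im z = 0 \<Longrightarrow> norm (G z) \<le> 1"
    and inf: "\<And>\<epsilon>. \<epsilon> > 0 \<Longrightarrow> \<forall>\<^sub>F z in at_infinity. Im z > 0 \<longrightarrow> norm (G z) \<le> 1 + \<epsilon>"
    and z: "Im z \<ge> 0"
  shows "norm (G z) \<le> 1"
proof (cases "Im z = 0")
  case True then show ?thesis using real by blast
next
  case False
  with z have z: "Im z > 0" by simp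
  have "norm (G z) \<le> 1 + \<epsilon>" if \<epsilon>: "\<epsilon> > 0" for \<epsilon>
  proof -
    obtain b where b: "\<And>w. norm w \<ge> b \<Longrightarrow> Im w > 0 \<Longrightarrow> norm (G w) \<le> 1 + \<epsilon>"
      using inf[OF \<epsilon>] by (auto simp: eventually_at_infinity)
    define R where "R = max b (norm z + 1)"
    define S where "S = ball 0 R \<inter> {w. Im w > 0}"
    have "open S" unfolding S_def by (intro open_Int open_ball open_halfspace_Im_gt)
    have clS: "closure S \<subseteq> cball 0 R \<inter> {w. Im w \<ge> 0}"
      unfolding S_def by (rule closure_minimal) (auto intro!: closed_Int closed_halfspace_Im_ge)
    show ?thesis
    proof (rule maximum_modulus_frontier[of G S])
      show "G holomorphic_on interior S"
        using \<open>open S\<close> by (simp add: interior_open) (rule holomorphic_on_subset[OF hol], auto simp: S_def)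
      show "continuous_on (closure S) G"
        using cont clS by (auto intro: continuous_on_subset)
      show "bounded S" unfolding S_def by (simp add: bounded_Int)
      show "z \<in> S" using z by (auto simp: S_def R_def)
      fix w assume w: "w \<in> frontier S"
      then have w1: "norm w \<le> R" "Im w \<ge> 0" using clS by (auto simp: frontier_def)
      have "w \<notin> S" using w \<open>open S\<close> by (simp add: frontier_def interior_open)
      then consider "Im w = 0" | "Im w > 0" "norm w = R" using w1 by (force simp: S_def)
      then show "norm (G w) \<le> 1 + \<epsilon>"
        by cases (use real[of w] \<epsilon> b[of w] in \<open>auto simp: R_def\<close>)
    qed
  qed
  then show ?thesis by (rule field_le_epsilon)
qed

lemma local_factorization_upper_half_plane:
  fixes F :: "complex \<Rightarrow> complex"
  assumes hol: "F holomorphic_on {z. Im z > 0}" and nc: "Im w > 0" "F w \<noteq> 0" and l: "Im l > 0"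
  obtains r h where "r > 0" "cball l r \<subseteq> {z. Im z > 0}" "h holomorphic_on cball l r" "zorder F l \<ge> 0"
    "\<And>v. v \<in> cball l r \<Longrightarrow> F v = h v * (v - l) ^ nat (zorder F l)"
    "\<And>v. v \<in> cball l r \<Longrightarrow> h v \<noteq> 0"
proof -
  have conn: "connected {z. Im z > 0}" by (intro convex_connected convex_halfspace_Im_gt)
  have *: "l \<in> {z. Im z > 0}" "\<exists>w\<in>{z. Im z > 0}. F w \<noteq> 0" using nc l by auto
  note Z = zorder_exist_zero[OF hol open_halfspace_Im_gt conn *]
  have zo: "zorder F l \<ge> 0" using Z by (auto split: if_splits)
  from conjunct2[OF Z] obtain r where r: "r > 0" "cball l r \<subseteq> {z. Im z > 0}"
      "zor_poly F l holomorphic_on cball l r"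
    and v: "\<forall>v\<in>cball l r. F v = zor_poly F l v * (v - l) ^ nat (zorder F l) \<and> zor_poly F l v \<noteq> 0"
    by blast
  show thesis
    by (rule that[OF r zo]) (use v in simp_all)
qed

text \<open>
  Dividing out a zero together with its full multiplicity preserves the bound 1: the quotient is bounded by 1 on
  the real axis, where the Blaschke factor is unimodular, and asymptotically at infinity. If \<open>l\<close> is not a zero
  then the exponent is 0 and nothing is divided out. The point \<open>w\<close> witnesses that \<open>F\<close> does not vanish identically.
\<close>

lemma blaschke_factor_out:
  fixes F :: "complex \<Rightarrow> complex"
  assumes hol: "F holomorphic_on {z. Im z > 0}" and cont: "continuous_on {z. Im z \<ge> 0} F"
    and le1: "\<And>z. Im z \<ge> 0 \<Longrightarrow> norm (F z) \<le> 1"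
    and nc: "Im w > 0" "F w \<noteq> 0" and l: "Im l > 0"
  obtains G where "G holomorphic_on {z. Im z > 0}" "continuous_on {z. Im z \<ge> 0} G"
    "\<And>z. Im z \<ge> 0 \<Longrightarrow> norm (G z) \<le> 1" "G l \<noteq> 0"
    "\<And>z. Im z \<ge> 0 \<Longrightarrow> F z = G z * blaschke l z ^ nat (zorder F l)"
proof -
  define n where "n = nat (zorder F l)"
  have op: "open {z. Im z > 0}" by (rule open_halfspace_Im_gt)
  from local_factorization_upper_half_plane[OF hol nc l]
  obtain r h where r: "r > 0" "cball l r \<subseteq> {z. Im z > 0}" "h holomorphic_on cball l r"
    and Fh: "\<And>w. w \<in> cball l r \<Longrightarrow> F w = h w * (w - l) ^ n" and hnz: "\<And>w. w \<in> cball l r \<Longrightarrow> h w \<noteq> 0"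
    unfolding n_def by metis
  \<comment> \<open>The value at \<open>l\<close> is the one that removes the singularity: near \<open>l\<close>, the quotient equals
     \<open>h z * (z - cnj l) ^ n\<close>.\<close>
  define G where "G = (\<lambda>z. if z = l then h l * (l - cnj l) ^ n else F z / blaschke l z ^ n)"
  have Gh: "G z = h z * (z - cnj l) ^ n" if "z \<in> cball l r" for z
  proof (cases "z = l")
    case False
    moreover have "Im z \<ge> 0" using that r by force
    ultimately show ?thesis
      using Fh[OF that] blaschke_den_nonzero[OF l, of z] by (simp add: G_def blaschke_def power_divide)
  qed (simp add: G_def)
  have hol1: "G holomorphic_on ball l r"
  proof -
    have "(\<lambda>z. h z * (z - cnj l) ^ n) holomorphic_on ball l r"
      by (intro holomorphic_intros holomorphic_on_subset[OF r(3)]) auto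
    then show ?thesis by (rule holomorphic_transform) (use Gh in auto)
  qed
  have hol2: "G holomorphic_on {z. Im z > 0} - {l}"
  proof -
    have "(\<lambda>z. F z / blaschke l z ^ n) holomorphic_on {z. Im z > 0} - {l}"
      using blaschke_nonzero[OF l]
      by (intro holomorphic_intros holomorphic_on_subset[OF hol] holomorphic_on_subset[OF holomorphic_on_blaschke[OF l]]) auto
    then show ?thesis by (rule holomorphic_transform) (auto simp: G_def)
  qed
  have holG: "G holomorphic_on {z. Im z > 0}"
  proof -
    have "G holomorphic_on ball l r \<union> ({z. Im z > 0} - {l})"
      by (intro holomorphic_on_Un hol1 hol2 open_ball open_Diff op closed_singleton)
    then show ?thesis by (rule holomorphic_on_subset) (use r in auto)
  qed
  have contG: "continuous_on {z. Im z \<ge> 0} G"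
  proof -
    have "continuous_on ({z. Im z \<ge> 0} - {l}) (\<lambda>z. F z / blaschke l z ^ n)"
      using blaschke_nonzero[OF l]
      by (intro continuous_intros continuous_on_subset[OF cont] continuous_on_subset[OF continuous_on_blaschke[OF l]]) auto
    then have c2: "continuous_on ({z. Im z \<ge> 0} - {l}) G"
      by (rule continuous_on_eq) (auto simp: G_def)
    show ?thesis
      unfolding continuous_on_eq_continuous_within
    proof
      fix z assume z: "z \<in> {z. Im z \<ge> 0}"
      show "continuous (at z within {z. Im z \<ge> 0}) G"
      proof (cases "z = l")
        case True
        have "isCont G l"
          using hol1 r(1) by (metis centre_in_ball holomorphic_on_imp_continuous_on continuous_on_interior interior_ball)
        then show ?thesis using True continuous_at_imp_continuous_at_within by blast
      next
        case False
        have "at z within {z. Im z \<ge> 0} - {l} = at z within {z. Im z \<ge> 0}"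
          by (rule at_within_nhd[of _ "- {l}"]) (use False in auto)
        then show ?thesis
          using c2 z False by (metis continuous_on_eq_continuous_within DiffI singletonD)
      qed
    qed
  qed
  have FG: "F z = G z * blaschke l z ^ n" if "Im z \<ge> 0" for z
  proof (cases "z = l")
    case True
    have "F l = h l * (l - l) ^ n" using Fh[of l] r by simp
    then show ?thesis using True by (cases "n = 0") (auto simp: G_def blaschke_def)
  next
    case False then show ?thesis using blaschke_nonzero[OF l that] by (simp add: G_def)
  qed
  have "G l \<noteq> 0" using hnz[of l] r l blaschke_den_nonzero[of l l] by (simp add: G_def)
  moreover have "norm (G z) \<le> 1" if "Im z \<ge> 0" for z
  proof (rule maximum_modulus_upper_half_plane[OF holG contG _ _ that])
    fix v assume v: "Im v = 0"
    then have "norm (F v) = norm (G v)"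
      using FG[of v] norm_blaschke_real[OF l v] by (simp add: norm_mult norm_power)
    then show "norm (G v) \<le> 1" using le1[of v] v by simp
  next
    fix \<epsilon> :: real assume \<epsilon>: "\<epsilon> > 0"
    have "((\<lambda>z. norm (blaschke l z ^ n)) \<longlongrightarrow> norm (1 ^ n :: complex)) at_infinity"
      by (intro tendsto_intros tendsto_blaschke_at_infinity)
    moreover have "inverse (1 + \<epsilon>) < norm (1 ^ n :: complex)" using \<epsilon> by (simp add: field_simps)
    ultimately have "\<forall>\<^sub>F z in at_infinity. inverse (1 + \<epsilon>) < norm (blaschke l z ^ n)"
      by (rule order_tendstoD(1))
    then show "\<forall>\<^sub>F z in at_infinity. Im z > 0 \<longrightarrow> norm (G z) \<le> 1 + \<epsilon>"
    proof eventually_elim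
      case (elim z)
      show ?case
      proof
        assume z: "Im z > 0"
        have "norm (G z) * inverse (1 + \<epsilon>) \<le> norm (G z) * norm (blaschke l z ^ n)"
          using elim by (intro mult_left_mono) auto
        also have "\<dots> = norm (F z)" using FG[of z] z by (simp add: norm_mult)
        also have "\<dots> \<le> 1" using le1[of z] z by simp
        finally show "norm (G z) \<le> 1 + \<epsilon>" using \<epsilon> by (simp add: field_simps)
      qed
    qed
  qed
  ultimately show thesis
    using that holG contG FG unfolding n_def by blast
qed

lemma finite_blaschke_factorization:
  fixes F :: "complex \<Rightarrow> complex"
  assumes hol: "F holomorphic_on {z. Im z > 0}" and cont: "continuous_on {z. Im z \<ge> 0} F"
    and le1: "\<And>z. Im z \<ge> 0 \<Longrightarrow> norm (F z) \<le> 1"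
    and nc: "Im w > 0" "F w \<noteq> 0" and fin: "finite Z" and Z: "\<And>l. l \<in> Z \<Longrightarrow> Im l > 0"
  obtains G where "G holomorphic_on {z. Im z > 0}" "continuous_on {z. Im z \<ge> 0} G"
    "\<And>z. Im z \<ge> 0 \<Longrightarrow> norm (G z) \<le> 1" "\<And>l. l \<in> Z \<Longrightarrow> G l \<noteq> 0"
    "\<And>z. Im z \<ge> 0 \<Longrightarrow> F z = G z * (\<Prod>l\<in>Z. blaschke l z ^ nat (zorder F l))"
proof -
  have "\<exists>G. G holomorphic_on {z. Im z > 0} \<and> continuous_on {z. Im z \<ge> 0} G \<and>
    (\<forall>z. Im z \<ge> 0 \<longrightarrow> norm (G z) \<le> 1) \<and> (\<forall>l\<in>Z. G l \<noteq> 0) \<and>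
    (\<forall>z. Im z \<ge> 0 \<longrightarrow> F z = G z * (\<Prod>l\<in>Z. blaschke l z ^ nat (zorder F l)))"
    using fin Z
  proof (induction Z rule: finite_induct)
    case empty
    show ?case using hol cont le1 by (intro exI[of _ F]) auto
  next
    case (insert l Z)
    then obtain G where G: "G holomorphic_on {z. Im z > 0}" "continuous_on {z. Im z \<ge> 0} G"
      "\<And>z. Im z \<ge> 0 \<Longrightarrow> norm (G z) \<le> 1" "\<And>l. l \<in> Z \<Longrightarrow> G l \<noteq> 0"
      and FG: "\<And>z. Im z \<ge> 0 \<Longrightarrow> F z = G z * (\<Prod>l\<in>Z. blaschke l z ^ nat (zorder F l))"
      by auto
    define P where "P = (\<lambda>z. \<Prod>l\<in>Z. blaschke l z ^ nat (zorder F l))"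
    have holP: "P holomorphic_on {z. Im z > 0}"
      unfolding P_def using insert.prems by (intro holomorphic_intros holomorphic_on_blaschke) auto
    have l: "Im l > 0" using insert.prems by auto
    have Pl: "P l \<noteq> 0"
    proof -
      have "blaschke m l \<noteq> 0" if "m \<in> Z" for m
        using insert.hyps insert.prems[of m] l that by (intro blaschke_nonzero) auto
      then show ?thesis unfolding P_def using insert.hyps by simp
    qed
    have Gw: "G w \<noteq> 0" using FG[of w] nc by auto
    \<comment> \<open>The factors divided out so far do not vanish at \<open>l\<close>, so they do not change the multiplicity there.\<close>
    have zo: "zorder F l = zorder G l"
    proof -
      from local_factorization_upper_half_plane[OF G(1) nc(1) Gw l]
      obtain r h where r: "r > 0" "cball l r \<subseteq> {z. Im z > 0}" "h holomorphic_on cball l r"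
        and pos: "zorder G l \<ge> 0"
        and Gh: "\<And>v. v \<in> cball l r \<Longrightarrow> G v = h v * (v - l) ^ nat (zorder G l)"
        and hnz: "\<And>v. v \<in> cball l r \<Longrightarrow> h v \<noteq> 0"
        by metis
      show ?thesis
      proof (rule zorder_eqI[of "ball l r" l "\<lambda>z. h z * P z"])
        have sub: "ball l r \<subseteq> {z. Im z > 0}" using r(2) ball_subset_cball by blast
        then show "(\<lambda>z. h z * P z) holomorphic_on ball l r"
          by (intro holomorphic_intros holomorphic_on_subset[OF r(3)] holomorphic_on_subset[OF holP]) auto
        show "h l * P l \<noteq> 0" using hnz[of l] r Pl by auto
        fix v assume v: "v \<in> ball l r" "v \<noteq> l"
        then have "Im v \<ge> 0" using sub by auto
        then have "F v = G v * P v" unfolding P_def by (rule FG)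
        also have "G v = h v * (v - l) ^ nat (zorder G l)" using Gh[of v] v by auto
        also have "(v - l) ^ nat (zorder G l) = (v - l) powi zorder G l"
          using pos by (simp add: power_int_def)
        finally show "F v = h v * P v * (v - l) powi zorder G l" by simp
      qed (use r in auto)
    qed
    from blaschke_factor_out[OF G(1,2,3) nc(1) Gw l] obtain H where H:
      "H holomorphic_on {z. Im z > 0}" "continuous_on {z. Im z \<ge> 0} H"
      "\<And>z. Im z \<ge> 0 \<Longrightarrow> norm (H z) \<le> 1" "H l \<noteq> 0"
      "\<And>z. Im z \<ge> 0 \<Longrightarrow> G z = H z * blaschke l z ^ nat (zorder G l)"
      by blast
    have "H m \<noteq> 0" if "m \<in> Z" for m
      using G(4)[OF that] H(5)[of m] insert.prems that by (metis insertI2 less_imp_le mult_zero_left)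
    then show ?case
      using H FG zo insert.hyps by (intro exI[of _ H]) (auto simp: mult_ac)
  qed
  then show thesis using that by blast
qed

section \<open>Sums over separated point sets\<close>

text \<open>
  The discs of radius \<open>\<delta>\<close> about the points are disjoint and contained in the disc of radius \<open>r + \<delta>\<close> about \<open>z\<close>;
  compare areas.
\<close>

lemma card_separated_le:
  fixes P :: "complex set"
  assumes fin: "finite P" and \<delta>: "\<delta> > 0" and r: "r \<ge> 0"
    and sep: "\<And>p q. \<lbrakk>p \<in> P; q \<in> P; p \<noteq> q\<rbrakk> \<Longrightarrow> 2 * \<delta> \<le> dist p q"
    and inside: "\<And>p. p \<in> P \<Longrightarrow> dist z p \<le> r"
  shows "real (card P) * \<delta>\<^sup>2 \<le> (r + \<delta>)\<^sup>2"
proof -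
  let ?V = "unit_ball_vol 2"
  have "disjoint_family_on (\<lambda>p. ball p \<delta>) P"
    unfolding disjoint_family_on_def
  proof (intro ballI impI)
    fix p q assume "p \<in> P" "q \<in> P" "p \<noteq> q"
    from sep[OF this] show "ball p \<delta> \<inter> ball q \<delta> = {}"
      using dist_triangle_less_add[of p _ \<delta> q \<delta>] by (fastforce simp: dist_commute)
  qed
  moreover have "emeasure lborel (ball p \<delta>) \<noteq> \<infinity>" for p :: complex
    using emeasure_lborel_ball_finite[of p \<delta>] by (rule less_imp_neq)
  ultimately have "measure lborel (\<Union>p\<in>P. ball p \<delta>) = (\<Sum>p\<in>P. measure lborel (ball p \<delta>))"
    using fin by (intro measure_finite_Union) auto
  also have "\<dots> = real (card P) * (?V * \<delta>\<^sup>2)"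
    using \<delta> by (simp add: content_ball)
  finally have "real (card P) * (?V * \<delta>\<^sup>2) = measure lborel (\<Union>p\<in>P. ball p \<delta>)" ..
  also have "\<dots> \<le> measure lborel (ball z (r + \<delta>))"
  proof (rule measure_mono_fmeasurable)
    show "(\<Union>p\<in>P. ball p \<delta>) \<subseteq> ball z (r + \<delta>)"
    proof
      fix v assume "v \<in> (\<Union>p\<in>P. ball p \<delta>)"
      then obtain p where "p \<in> P" "dist p v < \<delta>" by auto
      then show "v \<in> ball z (r + \<delta>)"
        using inside[of p] dist_triangle[of z v p] by simp
    qed
  qed (auto intro!: fmeasurableI sets.finite_UN fin simp: emeasure_lborel_ball_finite[unfolded infinity_ennreal_def])
  also have "\<dots> = ?V * (r + \<delta>)\<^sup>2"
    using \<delta> r by (simp add: content_ball)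
  finally have "?V * (real (card P) * \<delta>\<^sup>2) \<le> ?V * (r + \<delta>)\<^sup>2" by (simp add: mult_ac)
  then show ?thesis by (simp add: unit_ball_vol_pos)
qed

text \<open>
  A discrete version of the integral of \<open>1 / |w|\<close> over a disc, which is proportional to the radius. The proof adds
  one dyadic annulus at a time; the annulus of outer radius \<open>2 ^ m\<close> contains at most \<open>4 * (2 ^ m)\<^sup>2 / \<delta>\<^sup>2\<close> of the points.
\<close>

lemma sum_inverse_dist_separated_le:
  fixes P :: "complex set"
  assumes "finite P" and \<delta>: "0 < \<delta>" "\<delta> \<le> 1 / 2"
    and "\<And>p q. \<lbrakk>p \<in> P; q \<in> P; p \<noteq> q\<rbrakk> \<Longrightarrow> 2 * \<delta> \<le> dist p q"
    and "\<And>p. p \<in> P \<Longrightarrow> 1 / 2 \<le> dist z p"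
    and "\<And>p. p \<in> P \<Longrightarrow> dist z p < 2 ^ m / 2"
  shows "(\<Sum>p\<in>P. 1 / dist z p) \<le> 8 * 2 ^ m / \<delta>\<^sup>2"
  using assms(1,4-)
proof (induction m arbitrary: P)
  case 0
  then have "P = {}" by fastforce
  then show ?case by simp
next
  case (Suc m)
  define A where "A = {p \<in> P. dist z p < 2 ^ m / 2}"
  define B where "B = P - A"
  have A: "(\<Sum>p\<in>A. 1 / dist z p) \<le> 8 * 2 ^ m / \<delta>\<^sup>2"
    using Suc.prems by (intro Suc.IH) (auto simp: A_def)
  have "real (card B) * \<delta>\<^sup>2 \<le> (2 ^ m + \<delta>)\<^sup>2"
    using Suc.prems \<delta> by (intro card_separated_le[of B \<delta> "2 ^ m" z]) (auto simp: B_def intro!: less_imp_le)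
  also have "\<dots> \<le> (2 * 2 ^ m)\<^sup>2"
  proof (rule power_mono)
    have "(1::real) \<le> 2 ^ m" by simp
    then show "2 ^ m + \<delta> \<le> 2 * 2 ^ m" using \<delta> by linarith
  qed (use \<delta> in auto)
  finally have cB: "real (card B) \<le> 4 * (2 ^ m)\<^sup>2 / \<delta>\<^sup>2"
    using \<delta> by (simp add: field_simps)
  have "(\<Sum>p\<in>B. 1 / dist z p) \<le> (\<Sum>p\<in>B. 2 / 2 ^ m)"
  proof (rule sum_mono)
    fix p assume "p \<in> B"
    then have "dist z p \<ge> 2 ^ m / 2" by (auto simp: A_def B_def)
    then have "1 / dist z p \<le> 1 / (2 ^ m / 2)" by (intro divide_left_mono) (auto intro!: mult_pos_pos less_le_trans[of 0 "2 ^ m / 2" "dist z p"])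
    then show "1 / dist z p \<le> 2 / 2 ^ m" by simp
  qed
  also have "\<dots> = real (card B) * (2 / 2 ^ m)" by simp
  also have "\<dots> \<le> 4 * (2 ^ m)\<^sup>2 / \<delta>\<^sup>2 * (2 / 2 ^ m)"
    using cB by (intro mult_right_mono) auto
  also have "\<dots> = 8 * 2 ^ m / \<delta>\<^sup>2" by (simp add: power2_eq_square)
  finally have B: "(\<Sum>p\<in>B. 1 / dist z p) \<le> 8 * 2 ^ m / \<delta>\<^sup>2" .
  have "(\<Sum>p\<in>P. 1 / dist z p) = (\<Sum>p\<in>A. 1 / dist z p) + (\<Sum>p\<in>B. 1 / dist z p)"
    unfolding B_def using Suc.prems(1) by (subst sum.subset_diff[of A P]) (auto simp: A_def)
  with A B show ?case by simp
qed

text \<open>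
  The step in which the exponent \<open>1/4\<close> is decisive. Put \<open>z = x + \<i> / 2\<close>. Points at distance at least
  \<open>sqrt |x|\<close> from \<open>z\<close> contribute at most \<open>\<Sum> Im l / |x|\<close>, which is linear in \<open>|x|\<close> by the hypothesis on the total.
  Nearer points satisfy \<open>Im l \<le> 2 |z - l|\<close> and are separated by \<open>2 \<delta>\<close> with \<open>\<delta>\<close> of order \<open>|x| powr (-1/4)\<close>;
  their contribution is of order \<open>sqrt |x| / \<delta>\<^sup>2\<close>, which is again of order \<open>|x|\<close>.
\<close>

lemma separated_zeros_sum_le:
  fixes P :: "complex set" and x k c S :: real
  assumes fin: "finite P" and im: "\<And>l. l \<in> P \<Longrightarrow> Im l \<ge> 1"
    and total: "(\<Sum>l\<in>P. Im l) \<le> S * x\<^sup>2" and kc: "k > 0" "c > 0"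
    and sep: "\<And>z w. \<lbrakk>z \<in> P; w \<in> P; z \<noteq> w; Im z \<le> k * \<bar>Re z\<bar>; Im w \<le> k * \<bar>Re w\<bar>\<rbrakk>
                \<Longrightarrow> norm (z - w) \<ge> c * (norm z + norm w) powr (-1/4)"
    and x4: "\<bar>x\<bar> \<ge> 4" and xk: "1 / 2 + sqrt \<bar>x\<bar> \<le> k * (\<bar>x\<bar> - sqrt \<bar>x\<bar>)"
    and xc: "c * (4 * \<bar>x\<bar>) powr (-1/4) \<le> 1"
  shows "(\<Sum>l\<in>P. Im l / (norm (of_real x + \<i> / 2 - l))\<^sup>2) \<le> (S + 512 / c\<^sup>2) * \<bar>x\<bar>"
proof -
  define z where "z = complex_of_real x + \<i> / 2"
  define X where "X = \<bar>x\<bar>"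
  define \<delta> where "\<delta> = c / 2 * (4 * X) powr (-1/4)"
  define A where "A = {l \<in> P. dist z l < sqrt X}"
  define B where "B = P - A"
  have X4: "X \<ge> 4" using x4 by (simp add: X_def)
  have \<delta>: "0 < \<delta>" "\<delta> \<le> 1 / 2" using kc X4 xc by (auto simp: \<delta>_def X_def)
  have "((4 * X) powr (-1/4))\<^sup>2 = (4 * X) powr (-1/2)"
    by (simp add: power2_eq_square powr_add[symmetric])
  also have "\<dots> = 1 / (2 * sqrt X)"
    using X4 by (simp add: powr_minus_divide powr_half_sqrt real_sqrt_mult)
  finally have \<delta>2: "\<delta>\<^sup>2 = c\<^sup>2 / (8 * sqrt X)"
    by (simp add: \<delta>_def power_mult_distrib power_divide)
  have "X \<ge> 0" using X4 by linarith
  then have sX: "sqrt X * sqrt X = X" by simp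
  have sX2: "sqrt X \<ge> 2" using X4 by (intro real_le_rsqrt) simp
  have sX': "1 / 2 + sqrt X \<le> X"
  proof -
    have "2 * sqrt X \<le> sqrt X * sqrt X" by (intro mult_right_mono) (use sX2 in linarith)+
    then show ?thesis using sX sX2 by linarith
  qed
  have dist: "dist z l \<ge> 1 / 2" "Im l \<le> 2 * dist z l" if "l \<in> P" for l
    using im[OF that] abs_Im_le_cmod[of "l - z"]
    by (auto simp: dist_norm norm_minus_commute z_def)
  have near: "Im l \<le> k * \<bar>Re l\<bar>" "norm l \<le> 2 * X" if "l \<in> A" for l
  proof -
    have d: "norm (l - z) < sqrt X" using that by (simp add: A_def dist_norm norm_minus_commute)
    have "\<bar>Re l - x\<bar> < sqrt X" "Im l - 1 / 2 < sqrt X"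
      using abs_Re_le_cmod[of "l - z"] abs_Im_le_cmod[of "l - z"] d by (auto simp: z_def)
    then have "Im l \<le> 1 / 2 + sqrt X" "X - sqrt X \<le> \<bar>Re l\<bar>" unfolding X_def by linarith+
    moreover from this have "k * (X - sqrt X) \<le> k * \<bar>Re l\<bar>" using kc by (intro mult_left_mono) auto
    ultimately show "Im l \<le> k * \<bar>Re l\<bar>" using xk by (simp add: X_def)
    have "norm z \<le> X + 1 / 2" using norm_triangle_ineq[of "of_real x" "\<i> / 2"] by (simp add: z_def X_def)
    moreover have "norm l \<le> norm z + norm (l - z)" by (metis norm_triangle_sub)
    ultimately show "norm l \<le> 2 * X" using d sX' by linarith
  qed
  have sepA: "2 * \<delta> \<le> dist p q" if "p \<in> A" "q \<in> A" "p \<noteq> q" for p q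
  proof -
    have PQ: "p \<in> P" "q \<in> P" using that by (auto simp: A_def)
    have "norm p > 0" using im[OF PQ(1)] by auto
    then have "0 < norm p + norm q" by (simp add: add_pos_nonneg)
    moreover have "norm p + norm q \<le> 4 * X" using near(2)[OF that(1)] near(2)[OF that(2)] by simp
    ultimately have "(4 * X) powr (-1/4) \<le> (norm p + norm q) powr (-1/4)"
      by (intro powr_mono2') auto
    then have "2 * \<delta> \<le> c * (norm p + norm q) powr (-1/4)"
      using kc by (simp add: \<delta>_def)
    also have "\<dots> \<le> norm (p - q)" using sep PQ that near by blast
    finally show ?thesis by (simp add: dist_norm)
  qed
  obtain m :: nat where m: "2 * sqrt X \<le> 2 ^ m" "2 ^ m \<le> 4 * sqrt X"
  proof -
    define m where "m = (LEAST m::nat. 2 * sqrt X \<le> 2 ^ m)"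
    obtain n :: nat where "2 * sqrt X < 2 ^ n" using real_arch_pow[of 2 "2 * sqrt X"] by auto
    then have "2 * sqrt X \<le> 2 ^ n" by (rule less_imp_le)
    then have 1: "2 * sqrt X \<le> 2 ^ m"
      unfolding m_def by (rule LeastI[of "\<lambda>m. 2 * sqrt X \<le> 2 ^ m"])
    have "2 ^ m \<le> 4 * sqrt X"
    proof (cases m)
      case (Suc j)
      then have "\<not> 2 * sqrt X \<le> 2 ^ j" 
        using not_less_Least[of j "\<lambda>m. 2 * sqrt X \<le> 2 ^ m"] unfolding m_def by simp
      then show ?thesis using Suc by simp
    qed (use sX2 in simp)
    with 1 that show thesis by blast
  qed
  have "(\<Sum>l\<in>A. Im l / (dist z l)\<^sup>2) \<le> (\<Sum>l\<in>A. 2 * (1 / dist z l))"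
  proof (rule sum_mono)
    fix l assume "l \<in> A"
    then have "l \<in> P" by (simp add: A_def)
    from dist[OF this] show "Im l / (dist z l)\<^sup>2 \<le> 2 * (1 / dist z l)"
      by (simp add: power2_eq_square divide_simps split: if_splits)
  qed
  also have "\<dots> = 2 * (\<Sum>l\<in>A. 1 / dist z l)" by (simp only: sum_distrib_left)
  also have "(\<Sum>l\<in>A. 1 / dist z l) \<le> 8 * 2 ^ m / \<delta>\<^sup>2"
  proof (rule sum_inverse_dist_separated_le[OF _ \<delta> sepA])
    show "finite A" using fin by (simp add: A_def)
    fix p assume "p \<in> A"
    then have "p \<in> P" "dist z p < sqrt X" by (auto simp: A_def)
    then show "1 / 2 \<le> dist z p" "dist z p < 2 ^ m / 2" using dist m by auto
  qed
  also have "8 * 2 ^ m / \<delta>\<^sup>2 \<le> 8 * (4 * sqrt X) / \<delta>\<^sup>2"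
    using m by (intro divide_right_mono) auto
  also have "\<dots> = 256 * (sqrt X * sqrt X) / c\<^sup>2"
    using kc sX by (simp add: \<delta>2 field_simps)
  finally have sumA: "(\<Sum>l\<in>A. Im l / (dist z l)\<^sup>2) \<le> 512 * X / c\<^sup>2" using sX by simp
  have "(\<Sum>l\<in>B. Im l / (dist z l)\<^sup>2) \<le> (\<Sum>l\<in>B. Im l / X)"
  proof (rule sum_mono)
    fix l assume l: "l \<in> B"
    then have "sqrt X \<le> dist z l" by (auto simp: A_def B_def)
    then have "(sqrt X)\<^sup>2 \<le> (dist z l)\<^sup>2" using sX2 by (intro power_mono) linarith+
    moreover have "Im l \<ge> 1" using l im by (auto simp: B_def)
    ultimately show "Im l / (dist z l)\<^sup>2 \<le> Im l / X"
      using X4 by (intro divide_left_mono mult_pos_pos) auto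
  qed
  also have "\<dots> \<le> (\<Sum>l\<in>P. Im l / X)"
    using fin X4 by (intro sum_mono2) (auto simp: B_def dest: im)
  also have "\<dots> = (\<Sum>l\<in>P. Im l) / X" by (simp add: sum_divide_distrib)
  also have "\<dots> \<le> S * x\<^sup>2 / X" using total X4 by (intro divide_right_mono) auto
  also have "\<dots> = S * X" using X4 by (simp add: X_def power2_eq_square divide_simps abs_if)
  finally have sumB: "(\<Sum>l\<in>B. Im l / (dist z l)\<^sup>2) \<le> S * X" .
  have "(\<Sum>l\<in>P. Im l / (dist z l)\<^sup>2) = (\<Sum>l\<in>A. Im l / (dist z l)\<^sup>2) + (\<Sum>l\<in>B. Im l / (dist z l)\<^sup>2)"
    unfolding B_def using fin by (subst sum.subset_diff[of A P]) (auto simp: A_def)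
  with sumA sumB show ?thesis by (simp add: z_def X_def dist_norm algebra_simps)
qed

section \<open>The lower bound near the real axis\<close>

text \<open>
  The theorem for functions bounded by 1. For each large \<open>x\<close>, the finitely many zeros in the disc of radius \<open>9 |x|\<close>
  are divided out. The quotient \<open>G\<close> is estimated from its value at \<open>\<i> / 2\<close> and from the bound on the real axis, where
  \<open>|G| = |F|\<close>; the Blaschke product is estimated by the sum over the zeros.
\<close>

lemma bounded_lower_bound_near_real_axis:
  fixes F :: "complex \<Rightarrow> complex" and A R0 k c :: real and N :: nat
  assumes hol: "F holomorphic_on {z. Im z > 0}" and cont: "continuous_on {z. Im z \<ge> 0} F"
    and le1: "\<And>z. Im z \<ge> 0 \<Longrightarrow> norm (F z) \<le> 1"
    and mult: "\<And>l. \<lbrakk>Im l > 0; F l = 0\<rbrakk> \<Longrightarrow> zorder F l \<le> int N"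
    and real: "\<And>t. \<bar>t\<bar> \<ge> R0 \<Longrightarrow> norm (F (of_real t)) \<ge> exp (- A * \<bar>t\<bar>)" and A: "A \<ge> 0"
    and kc: "k > 0" "c > 0"
    and im_ge: "\<And>z. \<lbrakk>Im z > 0; F z = 0\<rbrakk> \<Longrightarrow> Im z \<ge> 1"
    and sep: "\<And>z w. \<lbrakk>Im z > 0; F z = 0; Im w > 0; F w = 0; z \<noteq> w; Im z \<le> k * \<bar>Re z\<bar>; Im w \<le> k * \<bar>Re w\<bar>\<rbrakk>
                \<Longrightarrow> norm (z - w) \<ge> c * (norm z + norm w) powr (-1/4)"
  obtains K where "\<forall>\<^sub>F x::real in at_infinity. - ln (norm (F (of_real x + \<i> / 2))) \<le> K * \<bar>x\<bar>"
proof -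
  define v0 where "v0 = - ln (norm (F (\<i> / 2)))"
  define K where "K = 3 / 2 * A + 864 * v0 + N * (100 * v0 + 512 / c\<^sup>2)"
  have Fi: "F (\<i> / 2) \<noteq> 0" using im_ge[of "\<i> / 2"] by auto
  have v0: "v0 \<ge> 0" using le1[of "\<i> / 2"] Fi by (simp add: v0_def)
  have bound: "- ln (norm (F (of_real x + \<i> / 2))) \<le> K * \<bar>x\<bar>"
    if x: "\<bar>x\<bar> \<ge> 4" "\<bar>x\<bar> \<ge> 2 * R0" "1 / 2 + sqrt \<bar>x\<bar> \<le> k * (\<bar>x\<bar> - sqrt \<bar>x\<bar>)" "c * (4 * \<bar>x\<bar>) powr (-1/4) \<le> 1" for x
  proof -
    define Z where "Z = {l. Im l > 0 \<and> F l = 0 \<and> norm l \<le> 9 * \<bar>x\<bar>}"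
    define n where "n = (\<lambda>l. nat (zorder F l))"
    define z where "z = complex_of_real x + \<i> / 2"
    have finZ: "finite Z"
    proof (cases "F constant_on {z. Im z > 0}")
      case True
      then have "Z = {}" using Fi unfolding constant_on_def Z_def by force
      then show ?thesis by simp
    next
      case False
      have "connected {z. Im z > 0}" by (intro convex_connected convex_halfspace_Im_gt)
      moreover have "compact (cball 0 (9 * \<bar>x\<bar>) \<inter> {z. Im z \<ge> 1})"
        by (intro compact_Int_closed compact_cball closed_halfspace_Im_ge)
      ultimately have "finite {l \<in> cball 0 (9 * \<bar>x\<bar>) \<inter> {z. Im z \<ge> 1}. F l = 0}"
        using hol False by (intro holomorphic_compact_finite_zeros[where S = "{z. Im z > 0}"] open_halfspace_Im_gt) auto
      then show ?thesis by (rule rev_finite_subset) (auto simp: Z_def im_ge)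
    qed
    have ImZ: "Im l \<ge> 1" "Im l > 0" if "l \<in> Z" for l using that im_ge by (auto simp: Z_def)
    have zF: "z \<notin> Z" "\<i> / 2 \<notin> Z" using ImZ(1)[of z] ImZ(1)[of "\<i> / 2"] by (auto simp: z_def)
    have n1: "1 \<le> n l" "n l \<le> N" if "l \<in> Z" for l
    proof -
      have l: "Im l > 0" "F l = 0" using that by (auto simp: Z_def)
      obtain r h where "r > 0" and Fh: "\<And>v. v \<in> cball l r \<Longrightarrow> F v = h v * (v - l) ^ n l"
        "\<And>v. v \<in> cball l r \<Longrightarrow> h v \<noteq> 0"
        using local_factorization_upper_half_plane[OF hol _ Fi l(1)] unfolding n_def by (metis half_gt_zero Im_divide_numeral imaginary_unit.simps(2) zero_less_one)
      show "1 \<le> n l" using Fh[of l] \<open>r > 0\<close> l by (cases "n l = 0") auto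
      show "n l \<le> N" using mult[OF l] by (simp add: n_def)
    qed
    obtain G where G: "G holomorphic_on {z. Im z > 0}" "continuous_on {z. Im z \<ge> 0} G"
      "\<And>z. Im z \<ge> 0 \<Longrightarrow> norm (G z) \<le> 1" "\<And>l. l \<in> Z \<Longrightarrow> G l \<noteq> 0"
      and FG: "\<And>z. Im z \<ge> 0 \<Longrightarrow> F z = G z * (\<Prod>l\<in>Z. blaschke l z ^ n l)"
      unfolding n_def
      by (rule finite_blaschke_factorization[OF hol cont le1 _ Fi finZ ImZ(2)]) auto
    have lnF: "- ln (norm (F w)) = - ln (norm (G w)) + (\<Sum>l\<in>Z. n l * - ln (norm (blaschke l w)))"
      if w: "Im w > 0" "F w \<noteq> 0" for w
    proof -
      have "w \<notin> Z" using w by (simp add: Z_def)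
      then have b: "blaschke l w \<noteq> 0" if "l \<in> Z" for l
        using blaschke_nonzero[of l w] that w ImZ by force
      have "ln (norm (\<Prod>l\<in>Z. blaschke l w ^ n l)) = ln (\<Prod>l\<in>Z. norm (blaschke l w) ^ n l)"
        by (simp add: prod_norm[symmetric] norm_power)
      also have "\<dots> = (\<Sum>l\<in>Z. ln (norm (blaschke l w) ^ n l))"
        using finZ b by (intro ln_prod) auto
      also have "\<dots> = (\<Sum>l\<in>Z. n l * ln (norm (blaschke l w)))"
        using b by (intro sum.cong) (auto simp: ln_realpow)
      finally have *: "ln (norm (\<Prod>l\<in>Z. blaschke l w ^ n l)) = (\<Sum>l\<in>Z. n l * ln (norm (blaschke l w)))" .
      have "norm (F w) = norm (G w) * norm (\<Prod>l\<in>Z. blaschke l w ^ n l)"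
        using FG[of w] w by (simp add: norm_mult)
      moreover have "norm (G w) \<noteq> 0" "norm (\<Prod>l\<in>Z. blaschke l w ^ n l) \<noteq> 0"
        using FG[of w] w by auto
      ultimately have "ln (norm (F w)) = ln (norm (G w)) + ln (norm (\<Prod>l\<in>Z. blaschke l w ^ n l))"
        by (simp add: ln_mult)
      then show ?thesis unfolding * by (simp add: sum_negf)
    qed
    have Gi: "- ln (norm (G (\<i> / 2))) \<ge> 0"
    proof -
      have "G (\<i> / 2) \<noteq> 0" using FG[of "\<i> / 2"] Fi by auto
      then show ?thesis using G(3)[of "\<i> / 2"] by simp
    qed
    \<comment> \<open>The Blaschke condition, read off at the point \<open>\<i> / 2\<close>: since \<open>|G| \<le> 1\<close> there, the product of the Blaschke
       factors is at least \<open>|F|\<close> at that point.\<close>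
    have blower: "Im l / (norm (\<i> / 2 - cnj l))\<^sup>2 \<le> n l * - ln (norm (blaschke l (\<i> / 2)))" if "l \<in> Z" for l
    proof -
      have "\<i> / 2 \<noteq> l" using that zF(2) by metis
      then have "Im l / (norm (\<i> / 2 - cnj l))\<^sup>2 \<le> - ln (norm (blaschke l (\<i> / 2)))"
        using neg_ln_norm_blaschke_lower[of l "\<i> / 2"] ImZ[OF that] by simp
      moreover have "0 \<le> Im l / (norm (\<i> / 2 - cnj l))\<^sup>2" using ImZ[OF that] by simp
      ultimately show ?thesis
        using n1[OF that] mult_right_mono[of 1 "real (n l)" "- ln (norm (blaschke l (\<i> / 2)))"] by linarith
    qed
    have blower0: "0 \<le> n l * - ln (norm (blaschke l (\<i> / 2)))" if "l \<in> Z" for l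
      using ImZ(2)[OF that] by (intro order_trans[OF _ blower[OF that]]) simp
    have v0G: "- ln (norm (G (\<i> / 2))) \<le> v0"
      using lnF[of "\<i> / 2"] Fi sum_nonneg[of Z, OF blower0] by (simp add: v0_def)
    have "(\<Sum>l\<in>Z. Im l / (norm (\<i> / 2 - cnj l))\<^sup>2) \<le> (\<Sum>l\<in>Z. n l * - ln (norm (blaschke l (\<i> / 2))))"
      by (intro sum_mono blower)
    also have "\<dots> \<le> v0" using lnF[of "\<i> / 2"] Fi Gi by (simp add: v0_def)
    finally have bl: "(\<Sum>l\<in>Z. Im l / (norm (\<i> / 2 - cnj l))\<^sup>2) \<le> v0" .
    have "(\<Sum>l\<in>Z. Im l) \<le> (\<Sum>l\<in>Z. (100 * x\<^sup>2) * (Im l / (norm (\<i> / 2 - cnj l))\<^sup>2))"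
    proof (rule sum_mono)
      fix l assume l: "l \<in> Z"
      have "norm (\<i> / 2 - cnj l) \<le> norm (\<i> / 2) + norm (cnj l)" by (rule norm_triangle_ineq4)
      also have "\<dots> \<le> 10 * \<bar>x\<bar>" using l x(1) by (simp add: Z_def)
      finally have "(norm (\<i> / 2 - cnj l))\<^sup>2 \<le> (10 * \<bar>x\<bar>)\<^sup>2" by (intro power_mono) auto
      moreover have "norm (\<i> / 2 - cnj l) > 0"
        using blaschke_den_nonzero[of l "\<i> / 2"] ImZ[OF l] by simp
      ultimately show "Im l \<le> (100 * x\<^sup>2) * (Im l / (norm (\<i> / 2 - cnj l))\<^sup>2)"
        using ImZ[OF l] by (simp add: pos_le_divide_eq mult.commute power_mult_distrib)
    qed
    also have "\<dots> = (100 * x\<^sup>2) * (\<Sum>l\<in>Z. Im l / (norm (\<i> / 2 - cnj l))\<^sup>2)" by (simp only: sum_distrib_left)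
    also have "\<dots> \<le> (100 * x\<^sup>2) * v0" using bl by (intro mult_left_mono) auto
    finally have total: "(\<Sum>l\<in>Z. Im l) \<le> 100 * v0 * x\<^sup>2" by (simp add: mult_ac)
    have sumZ: "(\<Sum>l\<in>Z. Im l / (norm (of_real x + \<i> / 2 - l))\<^sup>2) \<le> (100 * v0 + 512 / c\<^sup>2) * \<bar>x\<bar>"
      by (rule separated_zeros_sum_le[OF finZ ImZ(1) total kc _ x(1,3,4)]) (use sep in \<open>auto simp: Z_def\<close>)
    have lnG: "- ln (norm (G z)) \<le> 3 / 2 * A * \<bar>x\<bar> + 864 * - ln (norm (G (\<i> / 2)))"
      unfolding z_def
    proof (rule zero_free_lower_bound_near_real_axis[OF G(1-3)])
      fix w assume w: "Im w > 0" "norm w < 9 * \<bar>x\<bar>"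
      then show "G w \<noteq> 0" using G(4)[of w] FG[of w] by (cases "w \<in> Z") (auto simp: Z_def)
    next
      fix t assume t: "\<bar>t - x\<bar> \<le> \<bar>x\<bar> / 2"
      then have t': "\<bar>t\<bar> \<ge> R0" "\<bar>t\<bar> \<le> 3 / 2 * \<bar>x\<bar>" using x(2) by (auto simp: abs_if split: if_splits)
      have "norm (\<Prod>l\<in>Z. blaschke l (of_real t) ^ n l) = (\<Prod>l\<in>Z. norm (blaschke l (of_real t)) ^ n l)"
        by (simp add: prod_norm[symmetric] norm_power)
      also have "\<dots> = 1" using ImZ by (intro prod.neutral) (auto simp: norm_blaschke_real)
      finally have "norm (F (of_real t)) = norm (G (of_real t))"
        using FG[of "of_real t"] by (simp add: norm_mult)
      moreover have "exp (- (3 / 2 * A * \<bar>x\<bar>)) \<le> exp (- A * \<bar>t\<bar>)"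
        using mult_left_mono[OF t'(2) A] by (simp add: algebra_simps)
      ultimately show "exp (- (3 / 2 * A * \<bar>x\<bar>)) \<le> norm (G (of_real t))"
        using real[OF t'(1)] by linarith
    qed (use x in auto)
    have bupper: "n l * - ln (norm (blaschke l z)) \<le> N * (Im l / (norm (z - l))\<^sup>2)" if "l \<in> Z" for l
    proof -
      have "z \<noteq> l" using that zF(1) by metis
      then have "- ln (norm (blaschke l z)) \<le> Im l / (norm (z - l))\<^sup>2"
        using neg_ln_norm_blaschke_upper[of l z] ImZ[OF that] by (simp add: z_def)
      then have "n l * - ln (norm (blaschke l z)) \<le> n l * (Im l / (norm (z - l))\<^sup>2)"
        by (intro mult_left_mono) auto
      also have "\<dots> \<le> N * (Im l / (norm (z - l))\<^sup>2)"
        using n1[OF that] ImZ[OF that] by (intro mult_right_mono) auto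
      finally show ?thesis .
    qed
    have "F z \<noteq> 0" using im_ge[of z] by (auto simp: z_def)
    then have "- ln (norm (F z)) = - ln (norm (G z)) + (\<Sum>l\<in>Z. n l * - ln (norm (blaschke l z)))"
      by (intro lnF) (auto simp: z_def)
    also have "(\<Sum>l\<in>Z. n l * - ln (norm (blaschke l z))) \<le> (\<Sum>l\<in>Z. N * (Im l / (norm (z - l))\<^sup>2))"
      by (intro sum_mono bupper)
    also have "\<dots> = N * (\<Sum>l\<in>Z. Im l / (norm (z - l))\<^sup>2)" by (simp only: sum_distrib_left)
    also have "\<dots> \<le> N * ((100 * v0 + 512 / c\<^sup>2) * \<bar>x\<bar>)"
      using sumZ unfolding z_def by (intro mult_left_mono) auto
    finally have "- ln (norm (F z)) \<le> 3 / 2 * A * \<bar>x\<bar> + 864 * v0 + N * ((100 * v0 + 512 / c\<^sup>2) * \<bar>x\<bar>)"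
      using lnG v0G by linarith
    moreover have "864 * v0 * 1 \<le> 864 * v0 * \<bar>x\<bar>" using v0 x(1) by (intro mult_left_mono) auto
    ultimately show ?thesis unfolding z_def K_def by (simp add: algebra_simps)
  qed
  have ev: "\<forall>\<^sub>F x::real in at_infinity. P \<bar>x\<bar>" if "\<forall>\<^sub>F x::real in at_top. P x" for P
    using that filterlim_norm_at_top[where ?'a = real] unfolding filterlim_iff by (simp flip: real_norm_def)
  have "\<forall>\<^sub>F x::real in at_top. 1 / 2 + sqrt x \<le> k * (x - sqrt x)" using kc by real_asymp
  note e1 = ev[OF this]
  have "\<forall>\<^sub>F x::real in at_top. c * (4 * x) powr (-1/4) \<le> 1" using kc by real_asymp
  note e2 = ev[OF this]
  have "\<forall>\<^sub>F x::real in at_infinity. - ln (norm (F (of_real x + \<i> / 2))) \<le> K * \<bar>x\<bar>"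
    using ev[OF eventually_ge_at_top[of 4]] ev[OF eventually_ge_at_top[of "2 * R0"]] e1 e2
    by eventually_elim (rule bound)
  then show thesis by (rule that)
qed

theorem proposition2p6:
  fixes f :: "complex \<Rightarrow> complex" and \<alpha> C M k c :: real and \<Lambda> :: "complex set"
  assumes hol: "f holomorphic_on {z. Im z > 0}"
    and cont: "continuous_on {z. Im z \<ge> 0} f"
    and zeros: "\<Lambda> = {z. Im z > 0 \<and> f z = 0}"
    and mult: "\<exists>N::nat. \<forall>z\<in>\<Lambda>. zorder f z \<le> int N"
    and nonzero_real: "\<forall>\<^sub>F x::real in at_infinity. f (of_real x) \<noteq> 0"
    and log_real: "(\<lambda>x::real. ln (1 / norm (f (of_real x)))) \<in> O[at_infinity](\<lambda>x. \<bar>x\<bar>)"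
    and params: "\<alpha> \<ge> 0" "C > 0" "M \<ge> 0"
    and growth: "\<And>z. Im z \<ge> 0 \<Longrightarrow> norm (f z) \<le> C * (1 + norm z) powr M * exp (\<alpha> * Im z)"
    and kc: "k > 0" "c > 0"
    and im_ge: "\<And>z. z \<in> \<Lambda> \<Longrightarrow> Im z \<ge> 1"
    and sep: "\<And>z w. \<lbrakk>z \<in> \<Lambda>; w \<in> \<Lambda>; z \<noteq> w; Im z \<le> k * \<bar>Re z\<bar>; Im w \<le> k * \<bar>Re w\<bar>\<rbrakk>
                \<Longrightarrow> norm (z - w) \<ge> c * (norm z + norm w) powr (-1/4)"
  shows "(\<forall>\<^sub>F x::real in at_infinity. f (of_real x + \<i> / 2) \<noteq> 0) \<and>
         (\<lambda>x::real. - ln (norm (f (of_real x + \<i> / 2)))) \<in> O[at_infinity](\<lambda>x. \<bar>x\<bar>)"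
proof -
  \<comment> \<open>Normalise \<open>f\<close> to a function bounded by 1. The factor \<open>2 powr M\<close> accounts for
     \<open>1 + |z| \<le> 2 |z + \<i>|\<close> in the closed upper half-plane.\<close>
  define D where "D = C * 2 powr M"
  define F where "F = (\<lambda>z. f z * (exp (\<i> * of_real \<alpha> * z) / (of_real D * (z + \<i>) powr of_real M)))"
  have D: "D > 0" using params by (simp add: D_def)
  have ni: "norm (z + \<i>) \<ge> 1" "norm (z + \<i>) \<ge> norm z" if "Im z \<ge> 0" for z
  proof -
    show "norm (z + \<i>) \<ge> 1" using abs_Im_le_cmod[of "z + \<i>"] that by simp
    have "(norm z)\<^sup>2 \<le> (norm (z + \<i>))\<^sup>2"
      unfolding cmod_power2 using that by (simp add: power2_eq_square algebra_simps)
    then show "norm (z + \<i>) \<ge> norm z" by (rule power2_le_imp_le) simp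
  qed
  have nF: "norm (F z) = norm (f z) * (exp (- (\<alpha> * Im z)) / (D * norm (z + \<i>) powr M))" for z
    using D by (simp add: F_def norm_mult norm_divide norm_powr_real_powr')
  have slit: "z + \<i> \<notin> \<real>\<^sub>\<le>\<^sub>0" "z + \<i> \<noteq> 0" if "Im z \<ge> 0" for z
    using that by (auto simp: complex_nonpos_Reals_iff complex_eq_iff)
  have E_nz: "exp (\<i> * of_real \<alpha> * z) / (of_real D * (z + \<i>) powr of_real M) \<noteq> 0" if "Im z \<ge> 0" for z
    using slit[OF that] D by simp
  have E_hol: "(\<lambda>z. exp (\<i> * of_real \<alpha> * z) / (of_real D * (z + \<i>) powr of_real M)) holomorphic_on {z. Im z > 0}"
    using slit D by (intro holomorphic_intros) auto
  have F0: "F z = 0 \<longleftrightarrow> f z = 0" if "Im z \<ge> 0" for z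
    using E_nz[OF that] unfolding F_def by simp
  have Fhol: "F holomorphic_on {z. Im z > 0}"
    unfolding F_def by (intro holomorphic_on_mult hol E_hol)
  have Fcont: "continuous_on {z. Im z \<ge> 0} F"
    unfolding F_def using slit D by (intro continuous_intros cont) auto
  have Fle1: "norm (F z) \<le> 1" if "Im z \<ge> 0" for z
  proof -
    have "norm (f z) \<le> C * (1 + norm z) powr M * exp (\<alpha> * Im z)" by (rule growth[OF that])
    also have "\<dots> \<le> C * (2 * norm (z + \<i>)) powr M * exp (\<alpha> * Im z)"
      using ni[OF that] params by (intro mult_right_mono mult_left_mono powr_mono2) auto
    also have "\<dots> = D * norm (z + \<i>) powr M * exp (\<alpha> * Im z)"
      by (simp add: D_def powr_mult)
    finally have "norm (f z) * exp (- (\<alpha> * Im z)) \<le> D * norm (z + \<i>) powr M * exp (\<alpha> * Im z) * exp (- (\<alpha> * Im z))"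
      by (intro mult_right_mono) auto
    also have "\<dots> = D * norm (z + \<i>) powr M"
      by (simp only: mult.assoc exp_minus_inverse mult_1_right)
    finally have *: "norm (f z) * exp (- (\<alpha> * Im z)) \<le> D * norm (z + \<i>) powr M" .
    have "0 < D * norm (z + \<i>) powr M" using D slit[OF that] by simp
    with * show ?thesis unfolding nF times_divide_eq_right by (simp add: divide_le_eq)
  qed
  have lnF: "ln (norm (F z)) = ln (norm (f z)) - \<alpha> * Im z - ln D - M * ln (norm (z + \<i>))"
    if "Im z \<ge> 0" "f z \<noteq> 0" for z
    using that D slit[OF that(1)] unfolding nF by (simp add: ln_mult ln_div ln_powr)
  have lnb: "0 \<le> M * ln (norm (z + \<i>))" "M * ln (norm (z + \<i>)) \<le> M * (norm z + 1)" if "Im z \<ge> 0" for z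
  proof -
    show "0 \<le> M * ln (norm (z + \<i>))" using ni[OF that] params by simp
    have "ln (norm (z + \<i>)) \<le> norm (z + \<i>) - 1"
      using ni[OF that] by (intro ln_le_minus_one) auto
    also have "\<dots> \<le> norm z + 1" using norm_triangle_ineq[of z \<i>] by simp
    finally show "M * ln (norm (z + \<i>)) \<le> M * (norm z + 1)" using params by (intro mult_left_mono) auto
  qed
  \<comment> \<open>The zeros in the open half-plane have imaginary part at least 1, so none lies on the line \<open>Im z = 1 / 2\<close>.\<close>
  have half: "f (of_real x + \<i> / 2) \<noteq> 0" for x :: real
    using im_ge[of "of_real x + \<i> / 2"] by (auto simp: zeros)
  obtain N :: nat where N: "\<And>z. z \<in> \<Lambda> \<Longrightarrow> zorder f z \<le> int N" using mult by blast
  have multF: "zorder F l \<le> int N" if l: "Im l > 0" "F l = 0" for l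
  proof -
    have fl: "l \<in> \<Lambda>" using l F0[of l] by (simp add: zeros)
    have fi: "Im (\<i> / 2) > 0" "f (\<i> / 2) \<noteq> 0" using half[of 0] by auto
    obtain r h where r: "r > 0" "cball l r \<subseteq> {z. Im z > 0}" "h holomorphic_on cball l r" "zorder f l \<ge> 0"
      and fh: "\<And>v. v \<in> cball l r \<Longrightarrow> f v = h v * (v - l) ^ nat (zorder f l)"
        "\<And>v. v \<in> cball l r \<Longrightarrow> h v \<noteq> 0"
      using local_factorization_upper_half_plane[OF hol fi l(1)] by metis
    define E where "E = (\<lambda>z. exp (\<i> * of_real \<alpha> * z) / (of_real D * (z + \<i>) powr of_real M))"
    have sub: "ball l r \<subseteq> {z. Im z > 0}" using r(2) ball_subset_cball by blast
    have "zorder F l = zorder f l"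
    proof (rule zorder_eqI[of "ball l r" l "\<lambda>z. h z * E z"])
      show "(\<lambda>z. h z * E z) holomorphic_on ball l r"
        unfolding E_def
        by (intro holomorphic_on_mult holomorphic_on_subset[OF r(3)] holomorphic_on_subset[OF E_hol] sub) auto
      show "h l * E l \<noteq> 0" using fh(2)[of l] r(1) l(1) E_nz[of l] unfolding E_def by simp
      fix v assume "v \<in> ball l r"
      then have "f v = h v * (v - l) powi zorder f l"
        using fh(1)[of v] r(4) by (simp add: power_int_def)
      then show "F v = h v * E v * (v - l) powi zorder f l"
        by (simp add: F_def E_def)
    qed (use r in auto)
    then show ?thesis using N[OF fl] by simp
  qed
  obtain c0 where c0: "c0 > 0" "\<forall>\<^sub>F x::real in at_infinity. norm (ln (1 / norm (f (of_real x)))) \<le> c0 * norm \<bar>x\<bar>"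
    using landau_o.bigE[OF log_real] by blast
  obtain R1 where R1: "\<And>x::real. R1 \<le> \<bar>x\<bar> \<Longrightarrow> f (of_real x) \<noteq> 0 \<and> \<bar>ln (1 / norm (f (of_real x)))\<bar> \<le> c0 * \<bar>x\<bar>"
    using eventually_conj[OF nonzero_real c0(2)] unfolding eventually_at_infinity by auto
  define R0 where "R0 = max R1 1"
  define A where "A = c0 + \<bar>ln D\<bar> + 2 * M"
  have A: "A \<ge> 0" using c0 params by (simp add: A_def)
  have realF: "norm (F (of_real t)) \<ge> exp (- A * \<bar>t\<bar>)" if "\<bar>t\<bar> \<ge> R0" for t
  proof -
    have t: "R1 \<le> \<bar>t\<bar>" "1 \<le> \<bar>t\<bar>" using that by (auto simp: R0_def)
    have ft: "f (of_real t) \<noteq> 0" "ln (norm (f (of_real t))) \<ge> - (c0 * \<bar>t\<bar>)"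
      using R1[OF t(1)] by (auto simp: ln_div)
    have "\<bar>ln D\<bar> * 1 \<le> \<bar>ln D\<bar> * \<bar>t\<bar>" using t by (intro mult_left_mono) auto
    moreover have "M * (\<bar>t\<bar> + 1) \<le> M * (2 * \<bar>t\<bar>)" using t params by (intro mult_left_mono) auto
    moreover have "A * \<bar>t\<bar> = c0 * \<bar>t\<bar> + \<bar>ln D\<bar> * \<bar>t\<bar> + M * (2 * \<bar>t\<bar>)"
      by (simp add: A_def algebra_simps)
    moreover have "M * ln (norm (of_real t + \<i>)) \<le> M * (\<bar>t\<bar> + 1)"
      using lnb(2)[of "of_real t"] by simp
    moreover have "ln (norm (F (of_real t))) = ln (norm (f (of_real t))) - ln D - M * ln (norm (of_real t + \<i>))"
      using lnF[of "of_real t"] ft by simp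
    ultimately have "ln (norm (F (of_real t))) \<ge> - (A * \<bar>t\<bar>)"
      using ft(2) by linarith
    then have "ln (norm (F (of_real t))) \<ge> - A * \<bar>t\<bar>" by simp
    moreover have "norm (F (of_real t)) > 0" using F0[of "of_real t"] ft by simp
    ultimately show ?thesis by (simp add: ln_ge_iff)
  qed
  obtain K where K: "\<forall>\<^sub>F x::real in at_infinity. - ln (norm (F (of_real x + \<i> / 2))) \<le> K * \<bar>x\<bar>"
  proof (rule bounded_lower_bound_near_real_axis[OF Fhol Fcont Fle1 multF realF A kc])
    show "Im z \<ge> 1" if "Im z > 0" "F z = 0" for z
      using that F0[of z] by (intro im_ge) (simp add: zeros)
    show "c * (norm z + norm w) powr (-1/4) \<le> norm (z - w)"
      if "Im z > 0" "F z = 0" "Im w > 0" "F w = 0" "z \<noteq> w" "Im z \<le> k * \<bar>Re z\<bar>" "Im w \<le> k * \<bar>Re w\<bar>" for z w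
      using that F0[of z] F0[of w] by (intro sep) (simp_all add: zeros)
  qed auto
  define B where "B = \<bar>K\<bar> + \<alpha> + \<bar>ln D\<bar> + 3 * M"
  have "\<forall>\<^sub>F x::real in at_infinity. norm (- ln (norm (f (of_real x + \<i> / 2)))) \<le> B * norm \<bar>x\<bar>"
    using K eventually_at_infinityI[where P = "\<lambda>x::real. \<bar>x\<bar> \<ge> 1" and c = 1]
  proof (rule eventually_elim2)
    fix x :: real
    define z where "z = complex_of_real x + \<i> / 2"
    assume "- ln (norm (F (of_real x + \<i> / 2))) \<le> K * \<bar>x\<bar>" and x: "\<bar>x\<bar> \<ge> 1"
    then have Fz: "- ln (norm (F z)) \<le> K * \<bar>x\<bar>" by (simp add: z_def)
    have z: "Im z = 1 / 2" "f z \<noteq> 0" using half by (simp_all add: z_def)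
    have nz: "norm z \<le> \<bar>x\<bar> + 1 / 2"
      using norm_triangle_ineq[of "of_real x" "\<i> / 2"] by (simp add: z_def)
    have F1: "ln (norm (F z)) \<le> 0" using Fle1[of z] F0[of z] z by simp
    have "M * (norm z + 1) \<le> M * (3 * \<bar>x\<bar>)" using x nz params by (intro mult_left_mono) auto
    moreover have "\<bar>ln D\<bar> * 1 \<le> \<bar>ln D\<bar> * \<bar>x\<bar>" "\<alpha> * 1 \<le> \<alpha> * \<bar>x\<bar>" "0 \<le> M * \<bar>x\<bar>"
      using x params mult_left_mono[of 1 "\<bar>x\<bar>"] by auto
    moreover have "K * \<bar>x\<bar> \<le> \<bar>K\<bar> * \<bar>x\<bar>" "0 \<le> \<bar>K\<bar> * \<bar>x\<bar>" by (auto intro!: mult_right_mono)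
    moreover have "ln (norm (F z)) = ln (norm (f z)) - \<alpha> / 2 - ln D - M * ln (norm (z + \<i>))"
      using lnF[of z] z by simp
    moreover have "0 \<le> M * ln (norm (z + \<i>))" "M * ln (norm (z + \<i>)) \<le> M * (norm z + 1)"
      using lnb[of z] z by auto
    moreover have "B * \<bar>x\<bar> = \<bar>K\<bar> * \<bar>x\<bar> + \<alpha> * \<bar>x\<bar> + \<bar>ln D\<bar> * \<bar>x\<bar> + M * (3 * \<bar>x\<bar>)"
      by (simp add: B_def algebra_simps)
    ultimately have "\<bar>ln (norm (f z))\<bar> \<le> B * \<bar>x\<bar>" using F1 Fz params by linarith
    then show "norm (- ln (norm (f (of_real x + \<i> / 2)))) \<le> B * norm \<bar>x\<bar>" by (simp add: z_def)
  qed auto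
  then have "(\<lambda>x::real. - ln (norm (f (of_real x + \<i> / 2)))) \<in> O[at_infinity](\<lambda>x. \<bar>x\<bar>)"
    by (rule bigoI)
  with half show ?thesis by simp
qed

end
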